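(* Let $\{F_t\}_{t\ge0}$ be a one-dimensional symmetric nice Feller process with symbol $$q(x,\xi)=\frac12c(x)\xi^2+2\int_0^\infty(1-\cos\xi y)\nu(x,dy).$$ For $x\in\mathbb{R}$ and $r\ge y\ge0$ define $$R(x,r,y):=\nu\left(x,\bigcup_{n=0}^\infty\left(2nr+y,\,2(n+1)r-y\right]\right).$$ Then, for arbitrary $\rho>0$, $$\int_\rho^\infty\left(\sup_{x\in\mathbb{R}}\int_0^r yR(x,r,y)\,dy\right)^{-1}dr=\infty$$ if, and only if, $\int_{\{|\xi|<s\}}\frac{d\xi}{\sup_{x\in\mathbb{R}}|q(x,\xi)|}=\infty$ for some $s>0$. Further, if $\lim_{\xi\to0}\frac{\inf_{x\in\mathbb{R}}q(x,\xi)}{\xi^2}=\infty$, then $\int_{\{|\xi|<s\}}\frac{d\xi}{\inf_{x\in\mathbb{R}}q(x,\xi)}<\infty$ for some $s>0$ if, and only if, $$\int_\rho^\infty\left(\inf_{x\in\mathbb{R}}\int_0^r yR(x,r,y)\,dy\right)^{-1}dr<\infty$$ for all $\rho>0$ large enough.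
   Context: A Feller process $\{F_t\}_{t\ge0}$ on $\mathbb{R}$ is a Markov process with state space $(\mathbb{R},\mathcal{B}(\mathbb{R}))$, with laws $\mathbb{P}^x$ and expectations $\mathbb{E}^x$, whose semigroup $P_tf(x)=\mathbb{E}^x[f(F_t)]$ maps $C_\infty(\mathbb{R})$ (continuous functions vanishing at infinity, with the supremum norm) into itself and is strongly continuous there; it is strong Markov with càdlàg paths. Let $(\mathcal{A},\mathcal{D}_{\mathcal{A}})$ be its generator. Condition (C1): $C_c^\infty(\mathbb{R})\subseteq\mathcal{D}_{\mathcal{A}}$; then for $f\in C_c^\infty(\mathbb{R})$, $\mathcal{A}f(x)=-\int_{\mathbb{R}}q(x,\xi)e^{i\xi x}\hat f(\xi)\,d\xi$, $\hat f(\xi)=(2\pi)^{-1}\int e^{-i\xi x}f(x)\,dx$, where the symbol $q$ has a Lévy-Khintchine representation $q(x,\xi)=a(x)-i\xi b(x)+\frac12c(x)\xi^2-\int_{\mathbb{R}}(e^{i\xi y}-1-i\xi y1_{\{|y|\le1\}})\nu(x,dy)$, with $a,c\ge0$ and $b$ real-valued Borel functions and $\nu(x,dy)$ a Borel kernel (the Lévy measure) with $\nu(x,\{0\})=0$, $\int\min\{1,y^2\}\nu(x,dy)<\infty$. Condition (C2): for some $C\ge0$, $\sup_x|q(x,\xi)|\le C(1+\xi^2)$ for all $\xi$; equivalently $a$, $b$, $c$ and $x\mapsto\int\min\{1,y^2\}\nu(x,dy)$ are bounded. Condition (C3): $q(x,0)=a(x)=0$ for all $x$. For a $\sigma$-finite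 measure $\varphi$ the process is $\varphi$-irreducible if $\varphi(B)>0$ implies $\int_0^\infty\mathbb{P}^x(F_t\in B)\,dt>0$ for all $x$; then there is a maximal irreducibility measure $\psi$ (the process is $\bar\varphi$-irreducible iff $\bar\varphi\ll\psi$). Condition (C4): the process is irreducible and $\psi(O)>0$ for every nonempty open $O\subseteq\mathbb{R}$. A nice Feller process is a Feller process satisfying (C1)-(C4). It is symmetric if $q=\operatorname{Re}q$, i.e. $b=0$ and each $\nu(x,dy)$ is a symmetric measure, so that $q(x,\xi)=\frac12c(x)\xi^2+\int_{\mathbb{R}}(1-\cos\xi y)\nu(x,dy)\ge0$. Convention: $1/0=\infty$ in integrands. *)

theory Defs
  imports "HOL-Probability.Probability"
begin

section \<open>Markov and Feller processes on the real line\<close>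

text \<open>Time is a real parameter of which only the values t \<open>\<ge>\<close> 0 are used.\<close>

definition natural_filtration ::
    "'w measure \<Rightarrow> (real \<Rightarrow> 'w \<Rightarrow> real) \<Rightarrow> real \<Rightarrow> 'w measure" where
  "natural_filtration M F t =
     sigma (space M) {F u -` B \<inter> space M | u B. 0 \<le> u \<and> u \<le> t \<and> B \<in> sets borel}"

text \<open>\<open>M\<close> only carries the underlying measurable space; \<open>P x\<close> is the law of the process
  started at \<open>x\<close>. The Markov property is required for the natural filtration, which is the
  weakest such requirement. For Feller processes the strong Markov property is then a theorem,
  so it is not listed as an axiom.\<close>

locale markov_process =
  fixes M :: "'w measure" and P :: "real \<Rightarrow> 'w measure" and F :: "real \<Rightarrow> 'w \<Rightarrow> real"
  assumes prob_space_P: "\<And>x. prob_space (P x)"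
    and sets_P: "\<And>x. sets (P x) = sets M"
    and measurable_F: "\<And>t. 0 \<le> t \<Longrightarrow> F t \<in> borel_measurable M"
    and measurable_law: "\<And>t B. 0 \<le> t \<Longrightarrow> B \<in> sets borel \<Longrightarrow>
      (\<lambda>x. measure (P x) {\<omega> \<in> space M. F t \<omega> \<in> B}) \<in> borel_measurable borel"
    and start: "\<And>x. AE \<omega> in P x. F 0 \<omega> = x"
    and markov: "\<And>x s t B. 0 \<le> s \<Longrightarrow> 0 \<le> t \<Longrightarrow> B \<in> sets borel \<Longrightarrow>
      AE \<omega> in P x.
        real_cond_exp (P x) (natural_filtration M F s) (\<lambda>\<omega>'. indicator B (F (s + t) \<omega>')) \<omega> =
        measure (P (F s \<omega>)) {\<omega>' \<in> space M. F t \<omega>' \<in> B}"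
    and right_continuous: "\<And>\<omega> t. \<omega> \<in> space M \<Longrightarrow> 0 \<le> t \<Longrightarrow>
      continuous (at_right t) (\<lambda>s. F s \<omega>)"
    and left_limits: "\<And>\<omega> t. \<omega> \<in> space M \<Longrightarrow> 0 < t \<Longrightarrow>
      \<exists>l. ((\<lambda>s. F s \<omega>) \<longlongrightarrow> l) (at_left t)"

definition C_infinity :: "(real \<Rightarrow> real) set" where
  "C_infinity = {f. continuous_on UNIV f \<and> (f \<longlongrightarrow> 0) at_infinity}"

definition C_c_smooth :: "(real \<Rightarrow> real) set" where
  "C_c_smooth = {f. (\<forall>n. (deriv ^^ n) f differentiable_on UNIV) \<and> compact (closure {x. f x \<noteq> 0})}"

context markov_process
begin

definition semigroup :: "real \<Rightarrow> (real \<Rightarrow> real) \<Rightarrow> real \<Rightarrow> real" where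
  "semigroup t f x = (\<integral>\<omega>. f (F t \<omega>) \<partial>P x)"

definition has_generator_value :: "(real \<Rightarrow> real) \<Rightarrow> (real \<Rightarrow> real) \<Rightarrow> bool" where
  "has_generator_value f g \<longleftrightarrow> f \<in> C_infinity \<and> g \<in> C_infinity \<and>
     uniform_limit UNIV (\<lambda>t x. (semigroup t f x - f x) / t) g (at_right 0)"

definition generator_domain :: "(real \<Rightarrow> real) set" where
  "generator_domain = {f. \<exists>g. has_generator_value f g}"

definition generator :: "(real \<Rightarrow> real) \<Rightarrow> real \<Rightarrow> real" where
  "generator f = (THE g. has_generator_value f g)"

definition irreducible_wrt :: "real measure \<Rightarrow> bool" where
  "irreducible_wrt \<phi> \<longleftrightarrow>
     (\<forall>B\<in>sets borel. emeasure \<phi> B > 0 \<longrightarrow>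
        (\<forall>x. (\<integral>\<^sup>+t\<in>{0..}. emeasure (P x) {\<omega> \<in> space M. F t \<omega> \<in> B} \<partial>lborel) > 0))"

text \<open>In the library, \<open>absolutely_continuous \<psi> \<phi>\<close> means \<open>\<phi> \<lless> \<psi>\<close>.\<close>

definition maximal_irreducibility_measure :: "real measure \<Rightarrow> bool" where
  "maximal_irreducibility_measure \<psi> \<longleftrightarrow>
     sigma_finite_measure \<psi> \<and> sets \<psi> = sets borel \<and>
     (\<forall>\<phi>. sigma_finite_measure \<phi> \<and> sets \<phi> = sets borel \<longrightarrow>
        (irreducible_wrt \<phi> \<longleftrightarrow> absolutely_continuous \<psi> \<phi>))"

end

locale feller_process = markov_process +
  assumes feller: "\<And>t f. 0 \<le> t \<Longrightarrow> f \<in> C_infinity \<Longrightarrow> semigroup t f \<in> C_infinity"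
    and strongly_continuous: "\<And>f. f \<in> C_infinity \<Longrightarrow>
      uniform_limit UNIV (\<lambda>t. semigroup t f) f (at_right 0)"


section \<open>Symbols\<close>

definition fourier :: "(real \<Rightarrow> real) \<Rightarrow> real \<Rightarrow> complex" where
  "fourier f \<xi> = complex_of_real (1 / (2 * pi)) *
     (\<integral>x. exp (- \<i> * complex_of_real (\<xi> * x)) * complex_of_real (f x) \<partial>lborel)"

locale levy_characteristics =
  fixes a b c :: "real \<Rightarrow> real" and \<nu> :: "real \<Rightarrow> real measure"
  assumes measurable_a: "a \<in> borel_measurable borel"
    and measurable_b: "b \<in> borel_measurable borel"
    and measurable_c: "c \<in> borel_measurable borel"
    and a_nonneg: "\<And>x. 0 \<le> a x"
    and c_nonneg: "\<And>x. 0 \<le> c x"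
    and sets_nu: "\<And>x. sets (\<nu> x) = sets borel"
    and kernel_nu: "\<And>B. B \<in> sets borel \<Longrightarrow> (\<lambda>x. emeasure (\<nu> x) B) \<in> borel_measurable borel"
    and nu_zero: "\<And>x. emeasure (\<nu> x) {0} = 0"
    and nu_finite: "\<And>x. (\<integral>\<^sup>+y. ennreal (min 1 (y\<^sup>2)) \<partial>\<nu> x) < \<infinity>"

definition levy_khintchine ::
    "(real \<Rightarrow> real) \<Rightarrow> (real \<Rightarrow> real) \<Rightarrow> (real \<Rightarrow> real) \<Rightarrow> (real \<Rightarrow> real measure) \<Rightarrow>
     real \<Rightarrow> real \<Rightarrow> complex" where
  "levy_khintchine a b c \<nu> x \<xi> =
     complex_of_real (a x) - \<i> * complex_of_real (\<xi> * b x) + complex_of_real (c x * \<xi>\<^sup>2 / 2) -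
     (\<integral>y. (exp (\<i> * complex_of_real (\<xi> * y)) - 1 -
            \<i> * complex_of_real (\<xi> * y * indicator {- 1..1} y)) \<partial>\<nu> x)"

locale nice_feller_process =
  feller_process M P F + levy_characteristics a b c \<nu>
  for M :: "'w measure" and P F a b c \<nu> +
  fixes q :: "real \<Rightarrow> real \<Rightarrow> complex"
  assumes test_functions: "C_c_smooth \<subseteq> generator_domain"
    and symbol: "\<And>f x. f \<in> C_c_smooth \<Longrightarrow>
      complex_of_real (generator f x) =
        - (\<integral>\<xi>. q x \<xi> * exp (\<i> * complex_of_real (\<xi> * x)) * fourier f \<xi> \<partial>lborel)"
    and levy_khintchine: "\<And>x \<xi>. q x \<xi> = levy_khintchine a b c \<nu> x \<xi>"
    and bounded_coefficients: "\<exists>C\<ge>0. \<forall>x \<xi>. cmod (q x \<xi>) \<le> C * (1 + \<xi>\<^sup>2)"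
    and conservative: "\<And>x. q x 0 = 0"
    and open_set_irreducible: "\<exists>\<psi>. maximal_irreducibility_measure \<psi> \<and>
      (\<forall>U. open U \<and> U \<noteq> {} \<longrightarrow> emeasure \<psi> U > 0)"

text \<open>For a symmetric process uniqueness in the Levy-Khintchine formula gives \<open>b = 0\<close> and symmetric
  measures \<open>\<nu> x\<close>; together with \<open>a = 0\<close> this yields
  \<open>q x \<xi> = c x * \<xi>\<^sup>2 / 2 + 2 * \<integral>y\<in>{0<..}. (1 - cos (\<xi> * y)) \<partial>\<nu> x\<close>.\<close>

locale symmetric_nice_feller_process = nice_feller_process +
  assumes symmetric: "\<And>x \<xi>. q x \<xi> = complex_of_real (Re (q x \<xi>))"

definition R :: "(real \<Rightarrow> real measure) \<Rightarrow> real \<Rightarrow> real \<Rightarrow> real \<Rightarrow> ennreal" where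
  "R \<nu> x r y = emeasure (\<nu> x) (\<Union>n::nat. {2 * real n * r + y <.. 2 * (real n + 1) * r - y})"

end

theory Submission
  imports Defs
begin

text \<open>Only the symbol matters. Since the process is symmetric,
  \<open>q x \<xi> = c x * \<xi>\<^sup>2 / 2 + j x \<xi>\<close> with \<open>j x \<xi> = 2 * \<integral>y\<in>{0<..}. (1 - cos (\<xi> * y)) \<partial>\<nu> x\<close>.
  By Fubini, \<open>\<integral>y\<in>{0..r}. y * R \<nu> x r y\<close> is half the \<open>\<nu> x\<close>-integral over \<open>z > 0\<close> of the squared
  distance of \<open>z\<close> to \<open>2 r \<int>\<close>, hence comparable to \<open>r\<^sup>2 * j x (\<pi> / r)\<close> uniformly in \<open>x\<close>, and the
  substitution \<open>\<xi> = \<pi> / r\<close> turns the tail integrals into integrals of \<open>1 / sup j\<close> and \<open>1 / inf j\<close>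
  near \<open>0\<close>. The bounded coefficient \<open>c\<close> can be dropped: unless all \<open>\<nu> x\<close> vanish, \<open>sup j\<close> dominates a
  multiple of \<open>\<xi>\<^sup>2\<close> near \<open>0\<close>; in the second part \<open>inf q\<close> dominates every multiple of \<open>\<xi>\<^sup>2\<close>.\<close>

section \<open>Elementary inequalities, chiefly for 1 - cos\<close>

lemma mult_right_mono_indicator:
  assumes "x \<in> A \<Longrightarrow> f \<le> (g :: ennreal)"
  shows "f * indicator A x \<le> g * indicator A x"
  using assms by (cases "x \<in> A") auto

text \<open>Sine is concave on [0, pi], so it lies above its chord from 0 to pi/2.\<close>

lemma sin_ge_Jordan:
  fixes v :: real
  assumes "0 \<le> v" "v \<le> pi / 2"
  shows "2 / pi * v \<le> sin v"
proof -
  have "convex_on {0..pi} (\<lambda>x. - sin x)"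
  proof (rule f''_ge0_imp_convex)
    show "((\<lambda>x. - sin x) has_real_derivative - cos x) (at x)" for x :: real
      by (auto intro!: derivative_eq_intros)
    show "((\<lambda>x. - cos x) has_real_derivative sin x) (at x)" for x :: real
      by (auto intro!: derivative_eq_intros)
  qed (auto intro: sin_ge_zero)
  from convex_onD[OF this, of "2 / pi * v" 0 "pi / 2"] assms
  show ?thesis by (simp add: field_simps)
qed

lemma one_minus_cos_eq: "1 - cos u = 2 * (sin (u / 2))\<^sup>2" for u :: real
  using cos_double_sin[of "u / 2"] by simp

text \<open>Jordan's inequality at the half angle, squared; \<open>\<bar>u\<bar> \<le> pi\<close>
  keeps the half angle within [0, pi/2].\<close>

lemma one_minus_cos_ge:
  fixes u :: real
  assumes "\<bar>u\<bar> \<le> pi"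
  shows "2 / pi\<^sup>2 * u\<^sup>2 \<le> 1 - cos u"
proof -
  have "(2 / pi * (\<bar>u\<bar> / 2))\<^sup>2 \<le> (sin (\<bar>u\<bar> / 2))\<^sup>2"
    using assms by (intro power_mono sin_ge_Jordan) auto
  also have "(sin (\<bar>u\<bar> / 2))\<^sup>2 = (sin (u / 2))\<^sup>2"
    by (cases "u \<ge> 0") auto
  finally show ?thesis
    by (simp add: one_minus_cos_eq power_mult_distrib power_divide field_simps)
qed

lemma one_minus_cos_le: "1 - cos u \<le> u\<^sup>2 / 2" for u :: real
proof -
  have "\<bar>sin (u / 2)\<bar>\<^sup>2 \<le> \<bar>u / 2\<bar>\<^sup>2"
    by (intro power_mono abs_sin_x_le_abs_x) auto
  then show ?thesis by (simp add: one_minus_cos_eq power_divide)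
qed

text \<open>The quadratic bound serves for small jumps and the trivial bound 2 for large ones. The
  right-hand side is integrable against every Levy measure and grows with \<bar>\<xi>\<bar>, so it
  also dominates uniformly over bounded sets of \<xi>.\<close>

lemma norm_one_minus_cos_le: "norm (1 - cos (\<xi> * y)) \<le> (2 + \<xi>\<^sup>2) * min 1 (y\<^sup>2)" for \<xi> y :: real
proof -
  have "1 - cos (\<xi> * y) \<le> (2 + \<xi>\<^sup>2) * min 1 (y\<^sup>2)"
  proof (cases "y\<^sup>2 \<le> 1")
    case True
    have "1 - cos (\<xi> * y) \<le> \<xi>\<^sup>2 * y\<^sup>2"
      using one_minus_cos_le[of "\<xi> * y"] zero_le_power2[of "\<xi> * y"]
      unfolding power_mult_distrib by linarith
    also have "\<dots> \<le> (2 + \<xi>\<^sup>2) * y\<^sup>2" by (intro mult_right_mono) auto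
    finally show ?thesis using True by (simp add: min_def)
  next
    case False
    have "1 - cos (\<xi> * y) \<le> 2 + \<xi>\<^sup>2"
      using cos_ge_minus_one[of "\<xi> * y"] zero_le_power2[of \<xi>] by linarith
    then show ?thesis using False by (simp add: min_def)
  qed
  then show ?thesis by simp
qed

section \<open>Levy measures on the real line\<close>

locale levy_measure =
  fixes N :: "real measure"
  assumes sets_eq [measurable_cong, simp]: "sets N = sets borel"
    and emeasure_zero: "emeasure N {0} = 0"
    and finite_min: "(\<integral>\<^sup>+y. ennreal (min 1 (y\<^sup>2)) \<partial>N) < \<infinity>"
begin

lemma space_eq [simp]: "space N = UNIV"
  using sets_eq_imp_space_eq[OF sets_eq] by simp

lemma integrable_min: "integrable N (\<lambda>y. min 1 (y\<^sup>2))"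
  using finite_min by (intro integrableI_nonneg) auto

text \<open>By Markov's inequality for \<open>min 1 (y\<^sup>2)\<close>, the complement of each
  neighbourhood of 0 has finite mass, and 0 itself is null. Exchanging the integrals in
  \<open>tail_moment_eq\<close> relies on this.\<close>

lemma sigma_finite: "sigma_finite_measure N"
proof
  let ?A = "\<lambda>n::nat. {y::real. \<bar>y\<bar> \<ge> 1 / (real n + 1)}"
  have fin: "emeasure N (?A n) \<noteq> \<infinity>" for n
  proof -
    have "emeasure N (?A n) = (\<integral>\<^sup>+y. indicator (?A n) y \<partial>N)"
      by simp
    also have "\<dots> \<le> (\<integral>\<^sup>+y. ennreal ((real n + 1)\<^sup>2) * ennreal (min 1 (y\<^sup>2)) \<partial>N)"
    proof (intro nn_integral_mono)
      fix y :: real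
      show "indicator (?A n) y \<le> ennreal ((real n + 1)\<^sup>2) * ennreal (min 1 (y\<^sup>2))"
      proof (cases "y \<in> ?A n")
        case True
        then have "1 \<le> (real n + 1) * \<bar>y\<bar>" by (simp add: field_simps)
        then have "1 \<le> (real n + 1)\<^sup>2 * y\<^sup>2"
          by (metis abs_1 abs_mult abs_of_nonneg power2_abs power_mult_distrib one_le_power abs_ge_zero order_trans)
        moreover have "1 \<le> (real n + 1)\<^sup>2" by (intro one_le_power) auto
        ultimately have "1 \<le> (real n + 1)\<^sup>2 * min 1 (y\<^sup>2)" by (simp add: min_def)
        then show ?thesis using True
          by (simp flip: ennreal_mult' add: ennreal_1[symmetric] del: ennreal_1)
      qed simp
    qed
    also have "\<dots> = ennreal ((real n + 1)\<^sup>2) * (\<integral>\<^sup>+y. ennreal (min 1 (y\<^sup>2)) \<partial>N)"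
      by (intro nn_integral_cmult) auto
    also have "\<dots> < \<infinity>" using finite_min by (simp add: ennreal_mult_less_top)
    finally show ?thesis by simp
  qed
  have un: "\<exists>n. 1 / (real n + 1) \<le> \<bar>y\<bar>" if "y \<noteq> 0" for y :: real
    using reals_Archimedean[of "\<bar>y\<bar>"] that by (auto simp: inverse_eq_divide add.commute intro: less_imp_le)
  show "\<exists>A. countable A \<and> A \<subseteq> sets N \<and> \<Union> A = space N \<and> (\<forall>a\<in>A. emeasure N a \<noteq> \<infinity>)"
  proof (intro exI[of _ "insert {0} (range ?A)"] conjI ballI)
    show "insert {0} (range ?A) \<subseteq> sets N" by auto
    show "\<Union> (insert {0} (range ?A)) = space N" using un by force
    show "emeasure N A \<noteq> \<infinity>" if "A \<in> insert {0} (range ?A)" for A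
      using that fin emeasure_zero by auto
  qed auto
qed

section \<open>The jump symbol: continuity, periods and growth at the origin\<close>

text \<open>The integral runs over the whole line, so that the definition is meaningful before the
  symmetry of \<open>N\<close> is known; \<open>jump_symbol_half_line\<close> recovers the half-line
  form.\<close>

definition jump_symbol :: "real \<Rightarrow> real" where
  "jump_symbol \<xi> = (\<integral>y. 1 - cos (\<xi> * y) \<partial>N)"

lemma integrable_one_minus_cos: "integrable N (\<lambda>y. 1 - cos (\<xi> * y))"
proof (rule Bochner_Integration.integrable_bound)
  show "integrable N (\<lambda>y. (2 + \<xi>\<^sup>2) * min 1 (y\<^sup>2))" using integrable_min by simp
  show "AE y in N. norm (1 - cos (\<xi> * y)) \<le> norm ((2 + \<xi>\<^sup>2) * min 1 (y\<^sup>2))"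
    by (intro AE_I2 order_trans[OF norm_one_minus_cos_le]) simp
qed simp

lemma jump_symbol_nonneg: "0 \<le> jump_symbol \<xi>"
  unfolding jump_symbol_def by (intro integral_nonneg_AE) auto

lemma nn_integral_one_minus_cos: "(\<integral>\<^sup>+y. ennreal (1 - cos (\<xi> * y)) \<partial>N) = ennreal (jump_symbol \<xi>)"
  unfolding jump_symbol_def
  by (intro nn_integral_eq_integral integrable_one_minus_cos) auto

lemma jump_symbol_minus [simp]: "jump_symbol (- \<xi>) = jump_symbol \<xi>"
  by (simp add: jump_symbol_def)

text \<open>Dominated convergence along sequences. Continuity later makes suprema and infima over
  uncountably many starting points Borel measurable.\<close>

lemma continuous_jump_symbol: "continuous_on UNIV jump_symbol"
proof -
  have "continuous (at \<xi>) jump_symbol" for \<xi>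
    unfolding jump_symbol_def
  proof (rule continuous_at_imp_continuous_at_within, unfold continuous_at_sequentially comp_def, safe)
    fix u :: "nat \<Rightarrow> real" assume u: "u \<longlonglongrightarrow> \<xi>"
    \<comment> \<open>A convergent sequence is bounded, so one dominating function serves all its
      members.\<close>
    then obtain B where B: "\<And>n. \<bar>u n\<bar> \<le> B"
      using convergent_imp_Bseq[of u] by (auto simp: Bseq_def convergent_def)
    show "(\<lambda>n. \<integral>y. 1 - cos (u n * y) \<partial>N) \<longlonglongrightarrow> (\<integral>y. 1 - cos (\<xi> * y) \<partial>N)"
    proof (rule integral_dominated_convergence)
      show "integrable N (\<lambda>y. (2 + B\<^sup>2) * min 1 (y\<^sup>2))" using integrable_min by simp
      show "AE y in N. (\<lambda>n. 1 - cos (u n * y)) \<longlonglongrightarrow> 1 - cos (\<xi> * y)"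
        using u by (intro AE_I2 tendsto_intros)
      show "AE y in N. norm (1 - cos (u n * y)) \<le> (2 + B\<^sup>2) * min 1 (y\<^sup>2)" for n
      proof (rule AE_I2)
        fix y :: real
        have "(u n)\<^sup>2 \<le> B\<^sup>2" using B[of n] by (simp add: abs_le_square_iff[symmetric])
        then have "(2 + (u n)\<^sup>2) * min 1 (y\<^sup>2) \<le> (2 + B\<^sup>2) * min 1 (y\<^sup>2)"
          by (intro mult_right_mono) auto
        then show "norm (1 - cos (u n * y)) \<le> (2 + B\<^sup>2) * min 1 (y\<^sup>2)"
          by (rule order_trans[OF norm_one_minus_cos_le])
      qed
    qed auto
  qed
  then show ?thesis by (simp add: continuous_at_imp_continuous_on)
qed

text \<open>A zero \<open>\<eta>\<close> of the symbol forces \<open>N\<close> to live on the lattice \<open>(2 * pi / \<eta>) \<int>\<close>.\<close>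

lemma jump_symbol_periodic:
  assumes "jump_symbol \<eta> = 0"
  shows "jump_symbol (\<eta> + h) = jump_symbol h"
proof -
  have "AE y in N. 1 - cos (\<eta> * y) = 0"
    using assms integrable_one_minus_cos[of \<eta>]
    by (subst (asm) jump_symbol_def, subst (asm) integral_nonneg_eq_0_iff_AE) auto
  then have "AE y in N. 1 - cos ((\<eta> + h) * y) = 1 - cos (h * y)"
  proof eventually_elim
    case (elim y)
    then have "cos (\<eta> * y) = 1" by simp
    moreover from this have "sin (\<eta> * y) = 0" by (rule cos_one_sin_zero)
    ultimately show ?case by (simp add: distrib_right cos_add)
  qed
  then show ?thesis unfolding jump_symbol_def by (intro integral_cong_AE) auto
qed

text \<open>Some truncation of \<open>N\<close> to [-n, n] has positive mass off 0. For
  \<bar>\<xi>\<bar> below pi / (n + 1) the angle \<xi> y stays within [-pi, pi] there, so 1 - cos is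
  at least quadratic; \<open>k\<close> is \<open>2 / pi\<^sup>2\<close> times the truncated integral
  of \<open>min 1 (y\<^sup>2)\<close>.\<close>

lemma jump_symbol_ge_quadratic:
  assumes "\<not> (AE y in N. y = 0)"
  obtains k \<delta> where "0 < k" "0 < \<delta>" "\<And>\<xi>. \<bar>\<xi>\<bar> < \<delta> \<Longrightarrow> k * \<xi>\<^sup>2 \<le> jump_symbol \<xi>"
proof -
  let ?f = "\<lambda>n::nat. \<lambda>y. min 1 (y\<^sup>2) * indicator {- real n..real n} y"
  have int: "integrable N (?f n)" for n
    by (rule Bochner_Integration.integrable_bound[OF integrable_min]) (auto split: split_indicator)
  have "\<exists>n. (\<integral>y. ?f n y \<partial>N) \<noteq> 0"
  proof (rule ccontr)
    assume "\<nexists>n. (\<integral>y. ?f n y \<partial>N) \<noteq> 0"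
    then have "AE y in N. ?f n y = 0" for n
      using int[of n] by (subst integral_nonneg_eq_0_iff_AE[symmetric]) auto
    then have "AE y in N. \<forall>n. ?f n y = 0" unfolding AE_all_countable by blast
    then have "AE y in N. y = 0"
    proof eventually_elim
      case (elim y)
      obtain n :: nat where "\<bar>y\<bar> \<le> real n" using real_arch_simple by blast
      then have "y \<in> {- real n..real n}" by auto
      with elim[rule_format, of n] show ?case by (simp add: min_def split: if_splits)
    qed
    with assms show False by simp
  qed
  then obtain n where n: "(\<integral>y. ?f n y \<partial>N) \<noteq> 0" by blast
  moreover have "0 \<le> (\<integral>y. ?f n y \<partial>N)" by (intro integral_nonneg_AE) auto
  ultimately have pos: "0 < (\<integral>y. ?f n y \<partial>N)" by linarith
  show ?thesis
  proof (rule that)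
    show "0 < 2 / pi\<^sup>2 * (\<integral>y. ?f n y \<partial>N)" using pos by simp
    show "0 < pi / (real n + 1)" by simp
    fix \<xi> :: real assume \<xi>: "\<bar>\<xi>\<bar> < pi / (real n + 1)"
    have "2 / pi\<^sup>2 * (\<integral>y. ?f n y \<partial>N) * \<xi>\<^sup>2 = (\<integral>y. 2 / pi\<^sup>2 * \<xi>\<^sup>2 * ?f n y \<partial>N)"
      using int[of n] by simp
    also have "\<dots> \<le> jump_symbol \<xi>"
      unfolding jump_symbol_def
    proof (rule integral_mono)
      show "integrable N (\<lambda>y. 2 / pi\<^sup>2 * \<xi>\<^sup>2 * ?f n y)" using int[of n] by simp
      show "integrable N (\<lambda>y. 1 - cos (\<xi> * y))" by (rule integrable_one_minus_cos)
      fix y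
      show "2 / pi\<^sup>2 * \<xi>\<^sup>2 * ?f n y \<le> 1 - cos (\<xi> * y)"
      proof (cases "\<bar>y\<bar> \<le> real n")
        case True
        have "\<bar>\<xi>\<bar> * \<bar>y\<bar> \<le> pi / (real n + 1) * (real n + 1)"
          using \<xi> True by (intro mult_mono) auto
        then have "2 / pi\<^sup>2 * (\<xi> * y)\<^sup>2 \<le> 1 - cos (\<xi> * y)"
          by (intro one_minus_cos_ge) (simp add: abs_mult)
        moreover have "2 / pi\<^sup>2 * \<xi>\<^sup>2 * min 1 (y\<^sup>2) \<le> 2 / pi\<^sup>2 * \<xi>\<^sup>2 * y\<^sup>2"
          by (intro mult_left_mono) auto
        moreover have "indicator {- real n..real n} y = (1 :: real)" using True by (auto simp: indicator_def)
        ultimately show ?thesis by (simp add: power_mult_distrib mult.assoc)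
      next
        case False
        then have "indicator {- real n..real n} y = (0 :: real)" by (auto simp: indicator_def)
        then show ?thesis by simp
      qed
    qed
    finally show "2 / pi\<^sup>2 * (\<integral>y. ?f n y \<partial>N) * \<xi>\<^sup>2 \<le> jump_symbol \<xi>" .
  qed
qed

section \<open>Real and imaginary parts of the Levy-Khintchine integral\<close>

text \<open>Second-order Taylor expansion where the compensator is active, and the trivial bound 2
  outside.\<close>

lemma norm_levy_integrand_le:
  "norm (exp (\<i> * complex_of_real (\<xi> * y)) - 1 - \<i> * complex_of_real (\<xi> * y * indicator {- 1..1} y))
    \<le> (2 + \<xi>\<^sup>2) * min 1 (y\<^sup>2)"
proof (cases "\<bar>y\<bar> \<le> 1")
  case True
  have "norm (exp (\<i> * complex_of_real (\<xi> * y)) - (1 + \<i> * complex_of_real (\<xi> * y))) \<le> (\<xi> * y)\<^sup>2 / 2"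
    using iexp_approx1[of "\<xi> * y" 1] by (simp add: numeral_2_eq_2)
  also have "\<dots> \<le> \<xi>\<^sup>2 * y\<^sup>2" using zero_le_power2[of "\<xi> * y"] by (simp add: power_mult_distrib)
  also have "\<dots> \<le> (2 + \<xi>\<^sup>2) * y\<^sup>2" by (intro mult_right_mono) auto
  finally show ?thesis
    using True by (simp add: min_absorb2 abs_square_le_1 indicator_def diff_diff_eq abs_le_iff)
next
  case False
  have "norm (exp (\<i> * complex_of_real (\<xi> * y)) - 1) \<le> 1 + 1"
    by (rule order_trans[OF norm_triangle_ineq4]) simp
  also have "\<dots> \<le> 2 + \<xi>\<^sup>2" by simp
  finally have "norm (exp (\<i> * complex_of_real (\<xi> * y)) - 1) \<le> 2 + \<xi>\<^sup>2" .
  moreover have "1 \<le> y\<^sup>2" using False one_le_power[of "\<bar>y\<bar>" 2] by simp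
  moreover have "indicator {- 1..1} y = (0 :: real)" using False by (auto simp: indicator_def)
  ultimately show ?thesis by (simp add: min_absorb1)
qed

lemma integrable_levy_integrand:
  "integrable N (\<lambda>y. exp (\<i> * complex_of_real (\<xi> * y)) - 1 -
     \<i> * complex_of_real (\<xi> * y * indicator {- 1..1} y))"
proof (rule Bochner_Integration.integrable_bound)
  show "integrable N (\<lambda>y. (2 + \<xi>\<^sup>2) * min 1 (y\<^sup>2))" using integrable_min by simp
  show "AE y in N. norm (exp (\<i> * complex_of_real (\<xi> * y)) - 1 -
     \<i> * complex_of_real (\<xi> * y * indicator {- 1..1} y)) \<le> norm ((2 + \<xi>\<^sup>2) * min 1 (y\<^sup>2))"
    by (intro AE_I2 order_trans[OF norm_levy_integrand_le]) simp
qed simp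

text \<open>The compensator is purely imaginary and drops out of the real part.\<close>

lemma Re_levy_integral:
  "Re (\<integral>y. (exp (\<i> * complex_of_real (\<xi> * y)) - 1 -
     \<i> * complex_of_real (\<xi> * y * indicator {- 1..1} y)) \<partial>N) = - jump_symbol \<xi>"
  unfolding integral_Re[OF integrable_levy_integrand, symmetric] jump_symbol_def
  by (subst Bochner_Integration.integral_minus[symmetric])
     (intro Bochner_Integration.integral_cong, auto simp: Re_exp)

lemma integrable_sin_minus_linear:
  "integrable N (\<lambda>y. sin (\<xi> * y) - \<xi> * y * indicator {- 1..1} y)"
  using integrable_Im[OF integrable_levy_integrand[of \<xi>]] by (simp add: Im_exp)

lemma Im_levy_integral:
  "Im (\<integral>y. (exp (\<i> * complex_of_real (\<xi> * y)) - 1 -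
     \<i> * complex_of_real (\<xi> * y * indicator {- 1..1} y)) \<partial>N) =
   (\<integral>y. sin (\<xi> * y) - \<xi> * y * indicator {- 1..1} y \<partial>N)"
  unfolding integral_Im[OF integrable_levy_integrand, symmetric]
  by (intro Bochner_Integration.integral_cong) (auto simp: Im_exp)

text \<open>A second difference in \<open>\<xi>\<close> turns the hypothesis into the vanishing of the imaginary part of the
  characteristic function of the finite measure \<open>(1 - cos (h * y)) N(dy)\<close>, which is therefore
  symmetric.\<close>

lemma jump_symbol_half_line:
  assumes lin: "\<And>\<xi>. (\<integral>y. sin (\<xi> * y) - \<xi> * y * indicator {- 1..1} y \<partial>N) = \<beta> * \<xi>"
  shows "ennreal (jump_symbol h) = 2 * (\<integral>\<^sup>+y\<in>{0<..}. ennreal (1 - cos (h * y)) \<partial>N)"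
proof (cases "jump_symbol h = 0")
  \<comment> \<open>The mass used for normalisation in the other case would be 0 here, but then both
    sides vanish.\<close>
  case True
  have "(\<integral>\<^sup>+y\<in>{0<..}. ennreal (1 - cos (h * y)) \<partial>N) \<le> (\<integral>\<^sup>+y. ennreal (1 - cos (h * y)) \<partial>N)"
    by (intro nn_integral_mono) (auto split: split_indicator)
  then show ?thesis using True by (simp add: nn_integral_one_minus_cos)
next
  case False
  define m where "m = jump_symbol h"
  have m: "m > 0" using False jump_symbol_nonneg[of h] by (simp add: m_def)
  \<comment> \<open>Dividing by the total mass \<open>m\<close> gives a probability measure, as
    \<open>Levy_uniqueness\<close> requires.\<close>
  define K where "K = density N (\<lambda>y. ennreal ((1 - cos (h * y)) / m))"
  have sets_K [measurable_cong, simp]: "sets K = sets borel" by (simp add: K_def)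
  have em: "emeasure K A = ennreal (1 / m) * (\<integral>\<^sup>+y\<in>A. ennreal (1 - cos (h * y)) \<partial>N)"
    if [measurable]: "A \<in> sets borel" for A
  proof -
    have "emeasure K A = (\<integral>\<^sup>+y\<in>A. ennreal ((1 - cos (h * y)) / m) \<partial>N)"
      unfolding K_def by (subst emeasure_density) auto
    also have "\<dots> = (\<integral>\<^sup>+y. ennreal (1 / m) * (ennreal (1 - cos (h * y)) * indicator A y) \<partial>N)"
      using m by (intro nn_integral_cong)
        (auto simp: ennreal_mult[symmetric] split: split_indicator)
    finally show ?thesis by (simp add: nn_integral_cmult)
  qed
  have K1: "emeasure K UNIV = 1"
    using m by (subst em)
      (auto simp: nn_integral_one_minus_cos m_def[symmetric] ennreal_mult[symmetric])
  interpret K: real_distribution K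
  proof -
    have "prob_space K" using K1 by (intro prob_spaceI) (simp add: K_def)
    then show "real_distribution K" by (simp add: real_distribution_def real_distribution_axioms_def)
  qed
  have sin0: "(\<integral>y. sin (t * y) \<partial>K) = 0" for t
  proof -
    let ?s = "\<lambda>\<xi> y. sin (\<xi> * y) - \<xi> * y * indicator {- 1..1} y"
    have "(\<integral>y. sin (t * y) \<partial>K) = (\<integral>y. (1 - cos (h * y)) / m * sin (t * y) \<partial>N)"
      using m unfolding K_def by (subst integral_density) (auto intro!: AE_I2)
    \<comment> \<open>The product cos(h y) sin(t y) is the mean of sin((t + h) y) and sin((t - h)
      y). Since t is the mean of t + h and t - h, compensators can be inserted at no cost, and each
      compensated sine is integrable by itself.\<close>
    also have "\<dots> = (\<integral>y. (1 / m) * (?s t y - (?s (t + h) y + ?s (t - h) y) / 2) \<partial>N)"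
      by (intro Bochner_Integration.integral_cong)
         (auto simp: sin_add sin_diff algebra_simps add_divide_distrib diff_divide_distrib)
    also have "\<dots> = (1 / m) * (\<beta> * t - (\<beta> * (t + h) + \<beta> * (t - h)) / 2)"
      using integrable_sin_minus_linear[of t] integrable_sin_minus_linear[of "t + h"]
        integrable_sin_minus_linear[of "t - h"]
      by (simp only: integral_mult_right_zero Bochner_Integration.integral_diff
          Bochner_Integration.integral_add Bochner_Integration.integrable_add
          integral_divide_zero integrable_divide lin)
    finally show ?thesis by (simp add: algebra_simps)
  qed
  have dist: "real_distribution (distr K borel uminus)"
    by (simp add: real_distribution_def real_distribution_axioms_def K.prob_space_distr)
  have "char (distr K borel uminus) t = char K t" for t
  proof -
    have int: "integrable K (\<lambda>y. iexp (t * y))" for t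
      by (rule K.integrable_iexp) auto
    have "char K t - char (distr K borel uminus) t = (\<integral>y. iexp (t * y) \<partial>K) - (\<integral>y. iexp (- t * y) \<partial>K)"
      unfolding char_def by (simp add: integral_distr)
    also have "\<dots> = (\<integral>y. iexp (t * y) - iexp (- t * y) \<partial>K)"
      using int[of t] int[of "- t"] by (subst Bochner_Integration.integral_diff) auto
    also have "\<dots> = (\<integral>y. (2 * \<i>) * complex_of_real (sin (t * y)) \<partial>K)"
      by (intro Bochner_Integration.integral_cong) (auto simp: complex_eq_iff Re_exp Im_exp)
    also have "\<dots> = (2 * \<i>) * complex_of_real (\<integral>y. sin (t * y) \<partial>K)"
      by (simp only: integral_mult_right_zero integral_complex_of_real)
    finally show ?thesis by (simp add: sin0)
  qed
  then have "distr K borel uminus = K"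
    by (intro Levy_uniqueness[OF dist K.real_distribution_axioms]) auto
  then have "emeasure K {0<..} = emeasure (distr K borel uminus) {0<..}" by simp
  also have "\<dots> = emeasure K (uminus -` {0<..})" by (subst emeasure_distr) auto
  also have "uminus -` {0<..} = {..<0::real}" by auto
  finally have half: "emeasure K {0<..} = emeasure K {..<0}" .
  \<comment> \<open>The density vanishes at 0, so \<open>K\<close> has no atom there, and invariance
    under reflection leaves mass 1/2 for each open half-line.\<close>
  have "UNIV = {0::real} \<union> ({0<..} \<union> {..<0})" by auto
  then have "emeasure K UNIV = emeasure K ({0} \<union> ({0<..} \<union> {..<0}))" by simp
  also have "\<dots> = emeasure K {0} + emeasure K ({0<..} \<union> {..<0})"
    by (intro plus_emeasure[symmetric]) auto
  also have "emeasure K ({0<..} \<union> {..<0}) = emeasure K {0<..} + emeasure K {..<0}"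
    by (intro plus_emeasure[symmetric]) auto
  also have "emeasure K {0} = 0" by (simp add: em)
  finally have "emeasure K UNIV = emeasure K {0<..} + emeasure K {..<0}" by simp
  with half K1 have "1 = 2 * emeasure K {0<..}" by (simp add: mult_2)
  then have "ennreal m * 1 = ennreal m * (2 * (ennreal (1 / m) * (\<integral>\<^sup>+y\<in>{0<..}. ennreal (1 - cos (h * y)) \<partial>N)))"
    by (subst (asm) em) auto
  also have "\<dots> = 2 * ((ennreal m * ennreal (1 / m)) * (\<integral>\<^sup>+y\<in>{0<..}. ennreal (1 - cos (h * y)) \<partial>N))"
    by (simp only: ac_simps)
  also have "ennreal m * ennreal (1 / m) = 1" using m by (simp add: ennreal_mult[symmetric])
  finally show ?thesis by (simp add: m_def)
qed

section \<open>The tail moment and its comparison with the jump symbol\<close>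

text \<open>This is the inner integral of both criteria for one fixed Levy measure, with
  \<open>R\<close> unfolded.\<close>

definition tail_moment :: "real \<Rightarrow> ennreal" where
  "tail_moment r = (\<integral>\<^sup>+y\<in>{0..r}. ennreal y *
     emeasure N (\<Union>n::nat. {2 * real n * r + y <.. 2 * (real n + 1) * r - y}) \<partial>lborel)"

end

text \<open>The integral in the next lemma equals \<open>d\<^sup>2 / 2\<close>, where \<open>d\<close> is the distance of \<open>z\<close> to
  \<open>2 r \<int>\<close>; and \<open>1 - cos (\<pi> z / r) = 1 - cos (\<pi> d / r)\<close> is comparable to \<open>d\<^sup>2 / r\<^sup>2\<close>.\<close>

lemma periodized_moment_bounds:
  fixes r z :: real
  assumes r: "0 < r" and z: "0 < z"
  defines "J \<equiv> (\<integral>\<^sup>+y\<in>{0..r}. ennreal y *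
    indicator (\<Union>n::nat. {2 * real n * r + y <.. 2 * (real n + 1) * r - y}) z \<partial>lborel)"
  shows "ennreal (r\<^sup>2 / pi\<^sup>2 * (1 - cos (pi / r * z))) \<le> J" (is ?lower)
    and "J \<le> ennreal (r\<^sup>2 / 4 * (1 - cos (pi / r * z)))" (is ?upper)
proof -
  \<comment> \<open>\<open>n\<close> numbers the period of length 2r containing \<open>z\<close>,
    \<open>w\<close> is the position within it, and \<open>d\<close> the distance to its nearer
    end.\<close>
  define n where "n = nat \<lfloor>z / (2 * r)\<rfloor>"
  define w where "w = z - 2 * real n * r"
  define d where "d = min w (2 * r - w)"
  have n: "real n \<le> z / (2 * r)" "z / (2 * r) < real n + 1"
    using r z unfolding n_def by (simp_all add: of_nat_nat)
  then have w: "0 \<le> w" "w < 2 * r" using r by (auto simp: w_def field_simps)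
  have d: "0 \<le> d" "d \<le> r" using w by (auto simp: d_def)
  \<comment> \<open>The values 0 and \<open>w\<close> of \<open>y\<close> are excluded because the
    intervals are open on the left and closed on the right; they form a null set.\<close>
  have mem: "z \<in> (\<Union>n::nat. {2 * real n * r + y <.. 2 * (real n + 1) * r - y}) \<longleftrightarrow> y \<le> d"
    if y: "0 < y" "y \<noteq> w" for y
  proof
    assume "z \<in> (\<Union>n::nat. {2 * real n * r + y <.. 2 * (real n + 1) * r - y})"
    then obtain k :: nat where k: "2 * real k * r + y < z" "z \<le> 2 * (real k + 1) * r - y" by auto
    have "real k < z / (2 * r)" "z / (2 * r) < real k + 1" using k y r by (simp_all add: field_simps)
    with n have "real k < real n + 1" "real n < real k + 1" by linarith+
    then have "k = n" by linarith
    with k show "y \<le> d" by (simp add: d_def w_def algebra_simps)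
  next
    assume "y \<le> d"
    with y have "2 * real n * r + y < z" "z \<le> 2 * (real n + 1) * r - y"
      by (auto simp: d_def w_def algebra_simps)
    then show "z \<in> (\<Union>n::nat. {2 * real n * r + y <.. 2 * (real n + 1) * r - y})" by auto
  qed
  have "J = (\<integral>\<^sup>+y. ennreal y * indicator {0..d} y \<partial>lborel)"
    unfolding J_def
  proof (rule nn_integral_cong_AE)
    have "AE y in lborel. y \<noteq> 0 \<and> y \<noteq> w" using AE_lborel_singleton[of 0] AE_lborel_singleton[of w]
      by eventually_elim auto
    then show "AE y in lborel. ennreal y *
        indicator (\<Union>n::nat. {2 * real n * r + y <.. 2 * (real n + 1) * r - y}) z * indicator {0..r} y =
        ennreal y * indicator {0..d} y"
    proof eventually_elim
      case (elim y)
      show ?case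
      proof (cases "0 < y")
        case True
        with elim mem[of y] d show ?thesis by (simp add: indicator_def)
      next
        case False
        with elim show ?thesis by (simp add: indicator_def)
      qed
    qed
  qed
  also have "\<dots> = ennreal (d\<^sup>2 / 2 - 0\<^sup>2 / 2)"
    using d by (intro nn_integral_FTC_Icc) (auto intro!: derivative_eq_intros)
  finally have J: "J = ennreal (d\<^sup>2 / 2)" by simp
  \<comment> \<open>As a function of \<open>z\<close> the cosine has period 2r and is even, so it
    depends on \<open>d\<close> alone.\<close>
  have "cos (pi / r * z) = cos (pi / r * w + real n * (2 * pi))"
    using r by (simp add: w_def field_simps)
  also have "\<dots> = cos (pi / r * w)"
    using cos.plus_of_nat[of "pi / r * w" n] by simp
  also have "\<dots> = cos (pi / r * d)"
  proof (cases "w \<le> 2 * r - w")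
    case False
    then have "cos (pi / r * d) = cos (2 * pi - pi / r * w)"
      using r by (simp add: d_def field_simps)
    then show ?thesis by (simp add: cos_diff)
  qed (simp add: d_def)
  finally have cos_eq: "cos (pi / r * z) = cos (pi / r * d)" .
  have "r\<^sup>2 / pi\<^sup>2 * (1 - cos (pi / r * d)) \<le> r\<^sup>2 / pi\<^sup>2 * ((pi / r * d)\<^sup>2 / 2)"
    by (intro mult_left_mono one_minus_cos_le) auto
  also have "\<dots> = d\<^sup>2 / 2" using r by (simp add: power_mult_distrib power_divide)
  finally show ?lower unfolding J cos_eq by (rule ennreal_leI)
  \<comment> \<open>Since \<open>d \<le> r\<close>, the angle pi d / r lies in [0, pi], where
    \<open>one_minus_cos_ge\<close> applies.\<close>
  have "d\<^sup>2 / 2 = r\<^sup>2 / 4 * (2 / pi\<^sup>2 * (pi / r * d)\<^sup>2)"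
    using r by (simp add: power_mult_distrib power_divide)
  also have "\<dots> \<le> r\<^sup>2 / 4 * (1 - cos (pi / r * d))"
    using r d by (intro mult_left_mono one_minus_cos_ge) (auto simp: abs_mult field_simps)
  finally show ?upper unfolding J cos_eq by (rule ennreal_leI)
qed

context levy_measure begin

text \<open>Tonelli's theorem. For y \<ge> 0 all intervals lie in the positive half-line, which
  explains the restriction to z > 0.\<close>

lemma tail_moment_eq:
  assumes "0 < r"
  shows "tail_moment r = (\<integral>\<^sup>+z\<in>{0<..}. (\<integral>\<^sup>+y\<in>{0..r}. ennreal y *
    indicator (\<Union>n::nat. {2 * real n * r + y <.. 2 * (real n + 1) * r - y}) z \<partial>lborel) \<partial>N)"
proof -
  interpret N: sigma_finite_measure N by (rule sigma_finite)
  interpret pair_sigma_finite N lborel ..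
  let ?S = "\<lambda>y. \<Union>n::nat. {2 * real n * r + y <.. 2 * (real n + 1) * r - y}"
  let ?f = "\<lambda>z y. ennreal y * indicator (?S y) z * indicator {0..r} y"
  have "tail_moment r = (\<integral>\<^sup>+y. \<integral>\<^sup>+z. ?f z y \<partial>N \<partial>lborel)"
    unfolding tail_moment_def
  proof (rule nn_integral_cong)
    fix y
    have "(\<integral>\<^sup>+z. ?f z y \<partial>N) = (\<integral>\<^sup>+z. ennreal y * indicator {0..r} y * indicator (?S y) z \<partial>N)"
      by (simp only: ac_simps)
    also have "\<dots> = ennreal y * indicator {0..r} y * emeasure N (?S y)"
      by (subst nn_integral_cmult) auto
    finally show "ennreal y * emeasure N (?S y) * indicator {0..r} y = (\<integral>\<^sup>+z. ?f z y \<partial>N)"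
      by (simp only: ac_simps)
  qed
  also have "\<dots> = (\<integral>\<^sup>+z. \<integral>\<^sup>+y. ?f z y \<partial>lborel \<partial>N)"
  proof (rule Fubini')
    \<comment> \<open>Writing the union as a countable existential over pairs exhibits joint
      measurability.\<close>
    have "case_prod ?f = (\<lambda>p. ennreal (snd p) *
       indicator {p. \<exists>n::nat. 2 * real n * r + snd p < fst p \<and> fst p \<le> 2 * (real n + 1) * r - snd p} p *
       indicator {0..r} (snd p))"
      by (auto simp: fun_eq_iff indicator_def)
    also have "\<dots> \<in> borel_measurable (N \<Otimes>\<^sub>M lborel)"
      by measurable
    finally show "case_prod ?f \<in> borel_measurable (N \<Otimes>\<^sub>M lborel)" .
  qed
  also have "\<dots> = (\<integral>\<^sup>+z. (\<integral>\<^sup>+y. ?f z y \<partial>lborel) * indicator {0<..} z \<partial>N)"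
  proof (rule nn_integral_cong)
    fix z
    show "(\<integral>\<^sup>+y. ?f z y \<partial>lborel) = (\<integral>\<^sup>+y. ?f z y \<partial>lborel) * indicator {0<..} z"
    proof (cases "0 < z")
      case False
      have zero: "?f z y = 0" for y
      proof (cases "0 \<le> y")
        case True
        have "0 \<le> 2 * real n * r + y" for n using assms True by simp
        with False have "z \<notin> ?S y" by (auto simp: not_less intro: order_trans)
        then show ?thesis by simp
      qed auto
      have "(\<integral>\<^sup>+y. ?f z y \<partial>lborel) = (\<integral>\<^sup>+(y::real). 0 \<partial>lborel)" by (simp only: zero)
      then show ?thesis using False by simp
    qed simp
  qed
  finally show ?thesis .
qed

text \<open>Integration of \<open>periodized_moment_bounds\<close> over z > 0. The half-line
  integral is half the jump symbol, which halves both constants.\<close>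

lemma tail_moment_bounds:
  assumes lin: "\<And>\<xi>. (\<integral>y. sin (\<xi> * y) - \<xi> * y * indicator {- 1..1} y \<partial>N) = \<beta> * \<xi>"
    and r: "0 < r"
  shows "ennreal (r\<^sup>2 / (2 * pi\<^sup>2)) * ennreal (jump_symbol (pi / r)) \<le> tail_moment r"
    and "tail_moment r \<le> ennreal (r\<^sup>2 / 8) * ennreal (jump_symbol (pi / r))"
proof -
  let ?H = "\<integral>\<^sup>+z\<in>{0<..}. ennreal (1 - cos (pi / r * z)) \<partial>N"
  note H = jump_symbol_half_line[OF lin, of "pi / r"]
  have *: "ennreal k * ?H = (\<integral>\<^sup>+z\<in>{0<..}. ennreal (k * (1 - cos (pi / r * z))) \<partial>N)" if "0 \<le> k" for k
    using that by (subst nn_integral_cmult[symmetric]) (auto simp: ennreal_mult mult.assoc)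
  have c: "ennreal k * ennreal (jump_symbol (pi / r)) = ennreal (2 * k) * ?H" if "0 \<le> k" for k
    using that unfolding H by (simp add: ennreal_mult ac_simps)
  have "ennreal (r\<^sup>2 / pi\<^sup>2) * ?H \<le> tail_moment r"
    unfolding tail_moment_eq[OF r] using r
    by (subst *) (simp, intro nn_integral_mono mult_right_mono_indicator periodized_moment_bounds(1), auto)
  then show "ennreal (r\<^sup>2 / (2 * pi\<^sup>2)) * ennreal (jump_symbol (pi / r)) \<le> tail_moment r"
    by (subst c) auto
  have "tail_moment r \<le> ennreal (r\<^sup>2 / 4) * ?H"
    unfolding tail_moment_eq[OF r] using r
    by (subst *) (simp, intro nn_integral_mono mult_right_mono_indicator periodized_moment_bounds(2), auto)
  then show "tail_moment r \<le> ennreal (r\<^sup>2 / 8) * ennreal (jump_symbol (pi / r))"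
    by (subst c) auto
qed

end

section \<open>The substitution \<open>\<xi> = \<pi> / r\<close>\<close>

text \<open>Continuity from below of the measure with density \<open>f\<close>; it carries the
  substitution from compact intervals to half-lines.\<close>

lemma nn_set_integral_UN_incseq:
  fixes A :: "nat \<Rightarrow> 'a set" and f :: "'a \<Rightarrow> ennreal"
  assumes [measurable]: "f \<in> borel_measurable M" and A: "range A \<subseteq> sets M" and "incseq A"
  shows "(\<integral>\<^sup>+x\<in>(\<Union>n. A n). f x \<partial>M) = (SUP n. \<integral>\<^sup>+x\<in>A n. f x \<partial>M)"
proof -
  have *: "emeasure (density M f) B = (\<integral>\<^sup>+x\<in>B. f x \<partial>M)" if "B \<in> sets M" for B
    using that by (intro emeasure_density) auto
  have "(SUP n. emeasure (density M f) (A n)) = emeasure (density M f) (\<Union>n. A n)"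
    using assms by (intro SUP_emeasure_incseq) auto
  with A show ?thesis by (simp add: * range_subsetD sets.countable_UN)
qed

text \<open>The increasing map r \<mapsto> - pi / r has derivative \<open>pi / r\<^sup>2\<close>, so
  the substitution is made on the negative side, on compact intervals exhausting it. Evenness
  supplies the positive side and the factor 2.\<close>

lemma nn_integral_reciprocal_substitution:
  fixes G :: "real \<Rightarrow> ennreal"
  assumes [measurable]: "G \<in> borel_measurable borel"
    and even: "\<And>\<xi>. G (- \<xi>) = G \<xi>" and s: "0 < s"
  shows "(\<integral>\<^sup>+\<xi>\<in>{\<xi>. \<bar>\<xi>\<bar> < s}. G \<xi> \<partial>lborel) =
    2 * (\<integral>\<^sup>+r\<in>{pi / s<..}. G (pi / r) * ennreal (pi / r\<^sup>2) \<partial>lborel)"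
proof -
  \<comment> \<open>The right endpoints tend to infinity, so that pi / \<open>b n\<close> decreases
    to 0; the summand 1 keeps the intervals nondegenerate.\<close>
  define b where "b n = pi / s + real n + 1" for n
  have b: "pi / s < b n" "0 < b n" for n
    using s by (auto simp: b_def intro!: add_nonneg_pos)
  have sub: "(\<integral>\<^sup>+\<xi>\<in>{- s..- (pi / b n)}. G \<xi> \<partial>lborel) =
      (\<integral>\<^sup>+r\<in>{pi / s..b n}. G (pi / r) * ennreal (pi / r\<^sup>2) \<partial>lborel)" for n
  proof -
    have pos: "0 < x" if "x \<in> {pi / s..b n}" for x
      using that s by (auto intro: less_le_trans[of 0 "pi / s"])
    have "(\<integral>\<^sup>+\<xi>. G \<xi> * indicator {- (pi / (pi / s))..- (pi / b n)} \<xi> \<partial>lborel) =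
      (\<integral>\<^sup>+r. G (- (pi / r)) * ennreal (pi / r\<^sup>2) * indicator {pi / s..b n} r \<partial>lborel)"
    proof (rule nn_integral_substitution_aux)
      show "((\<lambda>r. - (pi / r)) has_real_derivative pi / x\<^sup>2) (at x)" if "x \<in> {pi / s..b n}" for x
        using pos[OF that] by (auto intro!: derivative_eq_intros simp: power2_eq_square)
      show "continuous_on {pi / s..b n} (\<lambda>x. pi / x\<^sup>2)"
        using pos by (intro continuous_intros) (auto dest: pos)
    qed (use b in auto)
    then show ?thesis using s by (simp add: even)
  qed
  have inc1: "incseq (\<lambda>n. {- s..- (pi / b n)})"
  proof (rule monoI)
    fix m n :: nat assume "m \<le> n"
    then have "pi / b n \<le> pi / b m"
      using b(2) by (intro divide_left_mono mult_pos_pos) (auto simp: b_def)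
    then show "{- s..- (pi / b m)} \<subseteq> {- s..- (pi / b n)}" by auto
  qed
  have un1: "(\<Union>n. {- s..- (pi / b n)}) = {- s..<0}"
  proof safe
    fix x assume x: "x \<in> {- s..<0}"
    obtain n :: nat where "pi / - x \<le> real n" using real_arch_simple by blast
    also have "\<dots> \<le> b n" using s by (simp add: b_def)
    finally have "pi / b n \<le> - x" using x b(2)[of n] by (simp add: field_simps)
    then show "x \<in> (\<Union>n. {- s..- (pi / b n)})" using x by (intro UN_I[of n]) auto
  next
    fix x n assume "x \<in> {- s..- (pi / b n)}"
    moreover have "0 < pi / b n" using b(2)[of n] by simp
    ultimately show "x \<in> {- s..<0}" by auto
  qed
  have inc2: "incseq (\<lambda>n. {pi / s..b n})" by (auto simp: incseq_def b_def)
  have un2: "(\<Union>n. {pi / s..b n}) = {pi / s..}"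
  proof (intro equalityI subsetI)
    fix x assume "x \<in> {pi / s..}"
    moreover obtain n :: nat where "x \<le> real n" using real_arch_simple by blast
    moreover have "real n \<le> b n" using s by (simp add: b_def)
    ultimately show "x \<in> (\<Union>n. {pi / s..b n})" by (intro UN_I[of n]) auto
  qed auto
  have "(\<integral>\<^sup>+\<xi>\<in>{- s..<0}. G \<xi> \<partial>lborel) = (SUP n. \<integral>\<^sup>+\<xi>\<in>{- s..- (pi / b n)}. G \<xi> \<partial>lborel)"
    unfolding un1[symmetric] by (rule nn_set_integral_UN_incseq) (use inc1 in auto)
  also have "\<dots> = (\<integral>\<^sup>+r\<in>{pi / s..}. G (pi / r) * ennreal (pi / r\<^sup>2) \<partial>lborel)"
    unfolding un2[symmetric] sub by (rule nn_set_integral_UN_incseq[symmetric]) (use inc2 in auto)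
  also have "\<dots> = (\<integral>\<^sup>+r\<in>{pi / s<..}. G (pi / r) * ennreal (pi / r\<^sup>2) \<partial>lborel)"
    by (rule nn_integral_cong_AE, rule AE_mp[OF AE_lborel_singleton[of "pi / s"]])
       (auto intro!: AE_I2 simp: indicator_def)
  finally have neg: "(\<integral>\<^sup>+\<xi>\<in>{- s..<0}. G \<xi> \<partial>lborel) =
    (\<integral>\<^sup>+r\<in>{pi / s<..}. G (pi / r) * ennreal (pi / r\<^sup>2) \<partial>lborel)" .
  have "(\<integral>\<^sup>+\<xi>\<in>{0<..s}. G \<xi> \<partial>lborel) = (\<integral>\<^sup>+\<xi>. G (- \<xi>) * indicator {0<..s} (- \<xi>) \<partial>lborel)"
    using nn_integral_real_affine[of "\<lambda>\<xi>. G \<xi> * indicator {0<..s} \<xi>" "- 1" 0] by simp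
  also have "\<dots> = (\<integral>\<^sup>+\<xi>\<in>{- s..<0}. G \<xi> \<partial>lborel)"
    by (intro nn_integral_cong) (auto simp: even indicator_def)
  finally have pos: "(\<integral>\<^sup>+\<xi>\<in>{0<..s}. G \<xi> \<partial>lborel) = (\<integral>\<^sup>+\<xi>\<in>{- s..<0}. G \<xi> \<partial>lborel)" .
  have "(\<integral>\<^sup>+\<xi>\<in>{\<xi>. \<bar>\<xi>\<bar> < s}. G \<xi> \<partial>lborel) =
      (\<integral>\<^sup>+\<xi>. G \<xi> * indicator {0<..s} \<xi> + G \<xi> * indicator {- s..<0} \<xi> \<partial>lborel)"
  proof (rule nn_integral_cong_AE)
    have "AE \<xi> in lborel. \<xi> \<noteq> 0 \<and> \<xi> \<noteq> s \<and> \<xi> \<noteq> - s"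
      using AE_lborel_singleton[of 0] AE_lborel_singleton[of s] AE_lborel_singleton[of "- s"]
      by eventually_elim auto
    then show "AE \<xi> in lborel. G \<xi> * indicator {\<xi>. \<bar>\<xi>\<bar> < s} \<xi> =
        G \<xi> * indicator {0<..s} \<xi> + G \<xi> * indicator {- s..<0} \<xi>"
      by eventually_elim (auto simp: indicator_def)
  qed
  also have "\<dots> = (\<integral>\<^sup>+\<xi>\<in>{0<..s}. G \<xi> \<partial>lborel) + (\<integral>\<^sup>+\<xi>\<in>{- s..<0}. G \<xi> \<partial>lborel)"
    by (rule nn_integral_add) auto
  finally show ?thesis unfolding pos neg by (simp add: mult_2)
qed

section \<open>Inverses and comparison of integrals in the extended nonnegative reals\<close>

lemma ennreal_inverse_antimono: "x \<le> y \<Longrightarrow> inverse y \<le> inverse x" for x y :: ennreal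
  including ennreal.lifting by transfer (auto intro: ereal_inverse_antimono)

lemma inverse_ennreal_mult:
  assumes "0 < k"
  shows "inverse (ennreal k * x) = ennreal (1 / k) * inverse x"
proof (cases x)
  case (real t)
  then show ?thesis
    using assms by (cases "t = 0")
      (auto simp: ennreal_mult[symmetric] inverse_ennreal divide_simps ennreal_mult_top)
qed (use assms in \<open>auto simp: ennreal_mult_top\<close>)

lemma ennreal_inverse_le_mult:
  assumes k: "0 < k" and le: "x \<le> ennreal k * y"
  shows "inverse y \<le> ennreal k * inverse x"
proof -
  have "ennreal k * inverse (ennreal k * y) \<le> ennreal k * inverse x"
    using le by (intro mult_left_mono ennreal_inverse_antimono) auto
  moreover have "ennreal k * inverse (ennreal k * y) = inverse y"
    using k by (simp add: inverse_ennreal_mult mult.assoc[symmetric] ennreal_mult[symmetric])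
  ultimately show ?thesis by simp
qed

lemma nn_integral_finite_comparison:
  assumes "v \<in> borel_measurable M" "\<And>x. u x \<le> ennreal k * v x" "(\<integral>\<^sup>+x. v x \<partial>M) < \<infinity>"
  shows "(\<integral>\<^sup>+x. u x \<partial>M) < \<infinity>"
proof -
  have "(\<integral>\<^sup>+x. u x \<partial>M) \<le> (\<integral>\<^sup>+x. ennreal k * v x \<partial>M)"
    by (intro nn_integral_mono assms)
  also have "\<dots> = ennreal k * (\<integral>\<^sup>+x. v x \<partial>M)" by (rule nn_integral_cmult[OF assms(1)])
  also have "\<dots> < \<infinity>" using assms(3) by (simp add: ennreal_mult_less_top)
  finally show ?thesis .
qed

text \<open>The bounds make \<open>A r\<close> comparable to \<open>r\<^sup>2 * H (pi / r)\<close>,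
  and the substitution contributes the matching weight \<open>pi / r\<^sup>2\<close>. Both bounds
  carry their factor on the left, the shape in which they pass to suprema and infima over starting
  points.\<close>

lemma nn_integral_tail_iff_near_zero:
  fixes A H :: "real \<Rightarrow> ennreal"
  assumes H [measurable]: "H \<in> borel_measurable borel" and even: "\<And>\<xi>. H (- \<xi>) = H \<xi>"
    and lower: "\<And>r. 0 < r \<Longrightarrow> ennreal (r\<^sup>2 / (2 * pi\<^sup>2)) * H (pi / r) \<le> A r"
    and upper: "\<And>r. 0 < r \<Longrightarrow> ennreal (8 / r\<^sup>2) * A r \<le> H (pi / r)"
    and \<rho>: "0 < \<rho>"
  shows "(\<integral>\<^sup>+r\<in>{\<rho><..}. inverse (A r) \<partial>lborel) < \<infinity> \<longleftrightarrow>
    (\<integral>\<^sup>+\<xi>\<in>{\<xi>. \<bar>\<xi>\<bar> < pi / \<rho>}. inverse (H \<xi>) \<partial>lborel) < \<infinity>"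
proof -
  let ?u = "\<lambda>r. inverse (A r) * indicator {\<rho><..} r"
  let ?v = "\<lambda>r. inverse (H (pi / r)) * ennreal (pi / r\<^sup>2) * indicator {\<rho><..} r"
  have "(\<integral>\<^sup>+\<xi>\<in>{\<xi>. \<bar>\<xi>\<bar> < pi / \<rho>}. inverse (H \<xi>) \<partial>lborel) = 2 * (\<integral>\<^sup>+r. ?v r \<partial>lborel)"
    using \<rho> even by (subst nn_integral_reciprocal_substitution) auto
  moreover have u_le_v: "?u r \<le> ennreal (2 * pi) * ?v r" for r
  proof (cases "\<rho> < r")
    case True
    with \<rho> have r: "0 < r" by simp
    have "inverse (A r) \<le> inverse (ennreal (r\<^sup>2 / (2 * pi\<^sup>2)) * H (pi / r))"
      using lower[OF r] by (rule ennreal_inverse_antimono)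
    also have "\<dots> = ennreal (2 * pi\<^sup>2 / r\<^sup>2) * inverse (H (pi / r))"
      using r by (subst inverse_ennreal_mult) auto
    also have "2 * pi\<^sup>2 / r\<^sup>2 = 2 * pi * (pi / r\<^sup>2)" by (simp add: power2_eq_square)
    also have "ennreal \<dots> * inverse (H (pi / r)) = ennreal (2 * pi) * (inverse (H (pi / r)) * ennreal (pi / r\<^sup>2))"
      by (subst ennreal_mult) (auto simp: ac_simps)
    finally show ?thesis using True by simp
  qed simp
  moreover have v_le_u: "?v r \<le> ennreal (pi / 8) * ?u r" for r
  proof (cases "\<rho> < r")
    case True
    with \<rho> have r: "0 < r" by simp
    have "inverse (H (pi / r)) \<le> inverse (ennreal (8 / r\<^sup>2) * A r)"
      using upper[OF r] by (rule ennreal_inverse_antimono)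
    also have "\<dots> = ennreal (r\<^sup>2 / 8) * inverse (A r)"
      using r by (subst inverse_ennreal_mult) auto
    finally have "inverse (H (pi / r)) * ennreal (pi / r\<^sup>2) \<le>
        ennreal (r\<^sup>2 / 8) * inverse (A r) * ennreal (pi / r\<^sup>2)"
      by (intro mult_right_mono) auto
    also have "\<dots> = ennreal (r\<^sup>2 / 8 * (pi / r\<^sup>2)) * inverse (A r)"
      by (subst ennreal_mult) (auto simp: ac_simps)
    also have "r\<^sup>2 / 8 * (pi / r\<^sup>2) = pi / 8" using r by simp
    finally show ?thesis using True by simp
  qed simp
  moreover have "(\<integral>\<^sup>+r. ?v r \<partial>lborel) < \<infinity>" if "(\<integral>\<^sup>+r. ?u r \<partial>lborel) < \<infinity>"
  proof -
    \<comment> \<open>The constant is moved to \<open>?v\<close>, which is measurable, because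
      \<open>A\<close> is an arbitrary function.\<close>
    have "ennreal (8 / pi) * ?v r \<le> ?u r" for r
    proof -
      have "ennreal (8 / pi) * ?v r \<le> ennreal (8 / pi) * (ennreal (pi / 8) * ?u r)"
        by (intro mult_left_mono v_le_u) auto
      also have "\<dots> = ?u r"
        by (simp add: mult.assoc[symmetric] ennreal_mult[symmetric])
      finally show ?thesis .
    qed
    then have "(\<integral>\<^sup>+r. ennreal (8 / pi) * ?v r \<partial>lborel) \<le> (\<integral>\<^sup>+r. ?u r \<partial>lborel)"
      by (rule nn_integral_mono)
    also note that
    finally have "(\<integral>\<^sup>+r. ennreal (8 / pi) * ?v r \<partial>lborel) < \<infinity>" .
    then show ?thesis by (subst (asm) nn_integral_cmult) (auto simp: ennreal_mult_less_top)
  qed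
  moreover have "(\<integral>\<^sup>+r. ?u r \<partial>lborel) < \<infinity>" if "(\<integral>\<^sup>+r. ?v r \<partial>lborel) < \<infinity>"
    by (rule nn_integral_finite_comparison[OF _ u_le_v that]) measurable
  ultimately show ?thesis by (auto simp: ennreal_mult_less_top)
qed

section \<open>Suprema and infima of continuous functions\<close>

text \<open>A supremum of continuous functions is lower semicontinuous: its strict superlevel sets
  are unions of open sets, whatever the size of the index set.\<close>

lemma borel_measurable_SUP_continuous:
  fixes f :: "'i \<Rightarrow> 'a :: topological_space \<Rightarrow> 'b :: {complete_linorder, linorder_topology, second_countable_topology}"
  assumes "\<And>i. i \<in> I \<Longrightarrow> continuous_on UNIV (f i)"
  shows "(\<lambda>x. SUP i\<in>I. f i x) \<in> borel_measurable borel"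
proof (rule borel_measurableI_greater)
  fix y
  have "{x. y < (SUP i\<in>I. f i x)} = (\<Union>i\<in>I. {x. y < f i x})" by (auto simp: less_SUP_iff)
  also have "open \<dots>" using assms by (intro open_UN ballI open_Collect_less) auto
  finally show "{x \<in> space borel. y < (SUP i\<in>I. f i x)} \<in> sets borel" by simp
qed

lemma borel_measurable_INF_continuous:
  fixes f :: "'i \<Rightarrow> 'a :: topological_space \<Rightarrow> 'b :: {complete_linorder, linorder_topology, second_countable_topology}"
  assumes "\<And>i. i \<in> I \<Longrightarrow> continuous_on UNIV (f i)"
  shows "(\<lambda>x. INF i\<in>I. f i x) \<in> borel_measurable borel"
proof (rule borel_measurableI_less)
  fix y
  have "{x. (INF i\<in>I. f i x) < y} = (\<Union>i\<in>I. {x. f i x < y})" by (auto simp: INF_less_iff)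
  also have "open \<dots>" using assms by (intro open_UN ballI open_Collect_less) auto
  finally show "{x \<in> space borel. (INF i\<in>I. f i x) < y} \<in> sets borel" by simp
qed

text \<open>Away from the zeros of the supremum its inverse is locally bounded, and at a zero it looks as
  at the origin. Compactness then shows that only the behaviour at the origin matters.\<close>

lemma nn_integral_inverse_SUP_finite:
  fixes f :: "'i \<Rightarrow> real \<Rightarrow> real"
  assumes cont: "\<And>i. continuous_on UNIV (f i)"
    and periodic: "\<And>\<eta> h i. (\<And>i. f i \<eta> \<le> 0) \<Longrightarrow> f i (\<eta> + h) = f i h"
    and t: "0 < t" and fin: "(\<integral>\<^sup>+\<xi>\<in>{\<xi>. \<bar>\<xi>\<bar> < t}. inverse (SUP i. ennreal (f i \<xi>)) \<partial>lborel) < \<infinity>"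
  shows "(\<integral>\<^sup>+\<xi>\<in>{\<xi>. \<bar>\<xi>\<bar> < s}. inverse (SUP i. ennreal (f i \<xi>)) \<partial>lborel) < \<infinity>"
proof -
  define H where "H \<xi> = (SUP i. ennreal (f i \<xi>))" for \<xi>
  have H [measurable]: "H \<in> borel_measurable borel"
    unfolding H_def using cont by (intro borel_measurable_SUP_continuous continuous_on_ennreal)
  have "\<exists>\<delta>>0. (\<integral>\<^sup>+\<xi>\<in>ball \<eta> \<delta>. inverse (H \<xi>) \<partial>lborel) < \<infinity>" for \<eta>
  proof (cases "\<exists>i. 0 < f i \<eta>")
    case True
    then obtain i where i: "0 < f i \<eta>" by blast
    \<comment> \<open>Near \<eta> the single function \<open>f i\<close> already keeps the supremum
      above half its value at \<eta>, so the inverse is bounded there.\<close>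
    have "open {\<xi>. f i \<eta> / 2 < f i \<xi>}" using cont by (intro open_Collect_less) auto
    then obtain \<delta> where \<delta>: "0 < \<delta>" "ball \<eta> \<delta> \<subseteq> {\<xi>. f i \<eta> / 2 < f i \<xi>}"
      using i openE[of "{\<xi>. f i \<eta> / 2 < f i \<xi>}" \<eta>] by auto
    have "(\<integral>\<^sup>+\<xi>\<in>ball \<eta> \<delta>. inverse (H \<xi>) \<partial>lborel) \<le>
        (\<integral>\<^sup>+\<xi>. inverse (ennreal (f i \<eta> / 2)) * indicator (ball \<eta> \<delta>) \<xi> \<partial>lborel)"
    proof (intro nn_integral_mono mult_right_mono_indicator ennreal_inverse_antimono)
      fix \<xi> assume "\<xi> \<in> ball \<eta> \<delta>"
      then have "ennreal (f i \<eta> / 2) \<le> ennreal (f i \<xi>)" using \<delta>(2) by (intro ennreal_leI) auto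
      also have "\<dots> \<le> H \<xi>" unfolding H_def by (rule SUP_upper) simp
      finally show "ennreal (f i \<eta> / 2) \<le> H \<xi>" .
    qed
    also have "\<dots> = inverse (ennreal (f i \<eta> / 2)) * emeasure lborel (ball \<eta> \<delta>)"
      by (rule nn_integral_cmult_indicator) simp
    also have "\<dots> < \<infinity>"
      using i \<delta>(1) by (simp add: ball_eq_greaterThanLessThan inverse_ennreal ennreal_mult_less_top)
    finally show ?thesis using \<delta>(1) by blast
  next
    case False
    then have "H (\<eta> + h) = H h" for h
      unfolding H_def by (intro SUP_cong arg_cong[of _ _ ennreal] periodic) (auto simp: not_less)
    moreover have [measurable]: "ball \<eta> t \<in> sets borel" by simp
    ultimately have "(\<integral>\<^sup>+\<xi>\<in>ball \<eta> t. inverse (H \<xi>) \<partial>lborel) =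
        (\<integral>\<^sup>+\<xi>. inverse (H \<xi>) * indicator (ball \<eta> t) (\<eta> + \<xi>) \<partial>lborel)"
      using nn_integral_real_affine[of "\<lambda>\<xi>. inverse (H \<xi>) * indicator (ball \<eta> t) \<xi>" 1 \<eta>] by simp
    also have "\<dots> = (\<integral>\<^sup>+\<xi>\<in>{\<xi>. \<bar>\<xi>\<bar> < t}. inverse (H \<xi>) \<partial>lborel)"
      by (intro nn_integral_cong) (auto simp: indicator_def dist_real_def)
    finally show ?thesis using fin t by (auto simp: H_def)
  qed
  then obtain \<delta> where \<delta>: "\<And>\<eta>. 0 < \<delta> \<eta>"
      "\<And>\<eta>. (\<integral>\<^sup>+\<xi>\<in>ball \<eta> (\<delta> \<eta>). inverse (H \<xi>) \<partial>lborel) < \<infinity>"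
    by metis
  have cover: "{- s..s} \<subseteq> (\<Union>\<eta>\<in>{- s..s}. ball \<eta> (\<delta> \<eta>))" using \<delta>(1) by force
  obtain D where D: "finite D" "{- s..s} \<subseteq> (\<Union>\<eta>\<in>D. ball \<eta> (\<delta> \<eta>))"
    by (rule compactE_image[OF _ _ cover]) auto
  have "(\<integral>\<^sup>+\<xi>\<in>{\<xi>. \<bar>\<xi>\<bar> < s}. inverse (H \<xi>) \<partial>lborel) \<le>
      (\<integral>\<^sup>+\<xi>. (\<Sum>\<eta>\<in>D. inverse (H \<xi>) * indicator (ball \<eta> (\<delta> \<eta>)) \<xi>) \<partial>lborel)"
  proof (rule nn_integral_mono)
    fix \<xi> :: real
    show "inverse (H \<xi>) * indicator {\<xi>. \<bar>\<xi>\<bar> < s} \<xi> \<le>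
        (\<Sum>\<eta>\<in>D. inverse (H \<xi>) * indicator (ball \<eta> (\<delta> \<eta>)) \<xi>)"
    proof (cases "\<bar>\<xi>\<bar> < s")
      case True
      then have "\<xi> \<in> {- s..s}" by auto
      with D obtain \<eta> where "\<eta> \<in> D" "\<xi> \<in> ball \<eta> (\<delta> \<eta>)" by blast
      then show ?thesis
        using True D(1) member_le_sum[of \<eta> D "\<lambda>\<eta>. inverse (H \<xi>) * indicator (ball \<eta> (\<delta> \<eta>)) \<xi>"] by auto
    qed simp
  qed
  also have "\<dots> = (\<Sum>\<eta>\<in>D. \<integral>\<^sup>+\<xi>\<in>ball \<eta> (\<delta> \<eta>). inverse (H \<xi>) \<partial>lborel)"
  proof (rule nn_integral_sum)
    fix \<eta>
    have [measurable]: "ball \<eta> (\<delta> \<eta>) \<in> sets borel" by simp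
    show "(\<lambda>\<xi>. inverse (H \<xi>) * indicator (ball \<eta> (\<delta> \<eta>)) \<xi>) \<in> borel_measurable lborel"
      by measurable
  qed
  also have "\<dots> < \<infinity>" using D(1) \<delta>(2) by simp
  finally show ?thesis by (simp add: H_def)
qed

section \<open>Symmetric nice Feller processes\<close>

context symmetric_nice_feller_process begin

lemma levy_measure_nu: "levy_measure (\<nu> x)"
  by unfold_locales (use sets_nu nu_zero nu_finite in auto)

abbreviation jump :: "real \<Rightarrow> real \<Rightarrow> real" where
  "jump x \<equiv> levy_measure.jump_symbol (\<nu> x)"

lemma killing_zero: "a x = 0"
  using conservative[of x] by (simp add: levy_khintchine levy_khintchine_def)

text \<open>Symmetry makes the symbol equal to its real part, to which drift and compensator do not
  contribute.\<close>

lemma symbol_eq: "q x \<xi> = complex_of_real (c x * \<xi>\<^sup>2 / 2 + jump x \<xi>)"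
proof -
  have "Re (q x \<xi>) = c x * \<xi>\<^sup>2 / 2 + jump x \<xi>"
    unfolding levy_khintchine levy_khintchine_def
    by (simp only: minus_complex.simps levy_measure.Re_levy_integral[OF levy_measure_nu])
       (simp add: killing_zero)
  with symmetric[of x \<xi>] show ?thesis by simp
qed

text \<open>The imaginary part of the symbol vanishes, so drift and compensated sine integral
  cancel. This is the hypothesis of \<open>jump_symbol_half_line\<close>.\<close>

lemma sin_integral_linear:
  "(\<integral>y. sin (\<xi> * y) - \<xi> * y * indicator {- 1..1} y \<partial>\<nu> x) = - b x * \<xi>"
proof -
  have "Im (q x \<xi>) = 0" by (simp add: symbol_eq)
  then show ?thesis
    unfolding levy_khintchine levy_khintchine_def
    by (simp only: minus_complex.simps levy_measure.Im_levy_integral[OF levy_measure_nu])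
       (simp add: killing_zero mult.commute)
qed

lemma jump_nonneg: "0 \<le> jump x \<xi>"
  by (rule levy_measure.jump_symbol_nonneg[OF levy_measure_nu])

lemma jump_minus: "jump x (- \<xi>) = jump x \<xi>"
  by (rule levy_measure.jump_symbol_minus[OF levy_measure_nu])

lemma continuous_jump: "continuous_on UNIV (jump x)"
  by (rule levy_measure.continuous_jump_symbol[OF levy_measure_nu])

lemma continuous_symbol: "continuous_on UNIV (\<lambda>\<xi>. c x * \<xi>\<^sup>2 / 2 + jump x \<xi>)"
  by (intro continuous_intros continuous_jump) auto

lemma symbol_nonneg: "0 \<le> c x * \<xi>\<^sup>2 / 2 + jump x \<xi>"
  using c_nonneg[of x] jump_nonneg[of x \<xi>] by simp

text \<open>At \<xi> = 1 the symbol is at most 2C and at least \<open>c x / 2\<close>; the added 1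
  makes the bound strictly positive.\<close>

lemma diffusion_bounded: obtains C where "0 < C" "\<And>x. c x \<le> C"
proof -
  obtain C where C: "0 \<le> C" "\<And>x \<xi>. cmod (q x \<xi>) \<le> C * (1 + \<xi>\<^sup>2)" using bounded_coefficients by blast
  have "c x \<le> 4 * C + 1" for x
    using C(2)[of x 1] jump_nonneg[of x 1] symbol_nonneg[of x 1] C(1)
    by (simp add: symbol_eq norm_of_real del: of_real_add)
  then show ?thesis using C(1) by (intro that[of "4 * C + 1"]) auto
qed

abbreviation moment :: "real \<Rightarrow> real \<Rightarrow> ennreal" where
  "moment x r \<equiv> \<integral>\<^sup>+y\<in>{0..r}. ennreal y * R \<nu> x r y \<partial>lborel"

lemma moment_eq: "moment x r = levy_measure.tail_moment (\<nu> x) r"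
  by (simp add: R_def levy_measure.tail_moment_def[OF levy_measure_nu])

lemma moment_lower:
  "0 < r \<Longrightarrow> ennreal (r\<^sup>2 / (2 * pi\<^sup>2)) * ennreal (jump x (pi / r)) \<le> moment x r"
  unfolding moment_eq
  by (rule levy_measure.tail_moment_bounds(1)[OF levy_measure_nu sin_integral_linear])

lemma moment_upper:
  assumes "0 < r"
  shows "ennreal (8 / r\<^sup>2) * moment x r \<le> ennreal (jump x (pi / r))"
proof -
  have "ennreal (8 / r\<^sup>2) * moment x r \<le> ennreal (8 / r\<^sup>2) * (ennreal (r\<^sup>2 / 8) * ennreal (jump x (pi / r)))"
    unfolding moment_eq using assms
    by (intro mult_left_mono levy_measure.tail_moment_bounds(2)[OF levy_measure_nu sin_integral_linear]) auto
  also have "\<dots> = ennreal (jump x (pi / r))"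
    using assms by (simp add: mult.assoc[symmetric] ennreal_mult[symmetric])
  finally show ?thesis .
qed

section \<open>Suprema and infima over the starting point\<close>

definition sup_jump :: "real \<Rightarrow> ennreal" where "sup_jump \<xi> = (SUP x. ennreal (jump x \<xi>))"
definition inf_jump :: "real \<Rightarrow> ennreal" where "inf_jump \<xi> = (INF x. ennreal (jump x \<xi>))"
definition sup_symbol :: "real \<Rightarrow> ennreal" where "sup_symbol \<xi> = (SUP x. ennreal (cmod (q x \<xi>)))"
definition inf_symbol :: "real \<Rightarrow> ennreal" where "inf_symbol \<xi> = (INF x. ennreal (Re (q x \<xi>)))"

lemma cmod_symbol: "cmod (q x \<xi>) = c x * \<xi>\<^sup>2 / 2 + jump x \<xi>"
  unfolding symbol_eq norm_of_real using symbol_nonneg by simp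

lemma Re_symbol: "Re (q x \<xi>) = c x * \<xi>\<^sup>2 / 2 + jump x \<xi>"
  by (simp only: symbol_eq Re_complex_of_real)

lemma measurable_extremal [measurable]:
  "sup_jump \<in> borel_measurable borel" "inf_jump \<in> borel_measurable borel"
  "sup_symbol \<in> borel_measurable borel" "inf_symbol \<in> borel_measurable borel"
  unfolding sup_jump_def inf_jump_def sup_symbol_def inf_symbol_def cmod_symbol Re_symbol
  by (intro borel_measurable_SUP_continuous borel_measurable_INF_continuous
      continuous_on_ennreal continuous_jump continuous_symbol)+

lemma sup_moment_iff_sup_jump:
  assumes "0 < \<rho>"
  shows "(\<integral>\<^sup>+r\<in>{\<rho><..}. inverse (SUP x. moment x r) \<partial>lborel) < \<infinity> \<longleftrightarrow>
    (\<integral>\<^sup>+\<xi>\<in>{\<xi>. \<bar>\<xi>\<bar> < pi / \<rho>}. inverse (sup_jump \<xi>) \<partial>lborel) < \<infinity>"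
proof (rule nn_integral_tail_iff_near_zero[OF _ _ _ _ assms])
  show "sup_jump (- \<xi>) = sup_jump \<xi>" for \<xi> by (simp add: sup_jump_def jump_minus)
  show "ennreal (r\<^sup>2 / (2 * pi\<^sup>2)) * sup_jump (pi / r) \<le> (SUP x. moment x r)" if "0 < r" for r
    unfolding sup_jump_def SUP_mult_left_ennreal by (rule SUP_mono') (rule moment_lower[OF that])
  show "ennreal (8 / r\<^sup>2) * (SUP x. moment x r) \<le> sup_jump (pi / r)" if "0 < r" for r
    unfolding sup_jump_def SUP_mult_left_ennreal by (rule SUP_mono') (rule moment_upper[OF that])
qed measurable

lemma inf_moment_iff_inf_jump:
  assumes "0 < \<rho>"
  shows "(\<integral>\<^sup>+r\<in>{\<rho><..}. inverse (INF x. moment x r) \<partial>lborel) < \<infinity> \<longleftrightarrow>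
    (\<integral>\<^sup>+\<xi>\<in>{\<xi>. \<bar>\<xi>\<bar> < pi / \<rho>}. inverse (inf_jump \<xi>) \<partial>lborel) < \<infinity>"
proof (rule nn_integral_tail_iff_near_zero[OF _ _ _ _ assms])
  show "inf_jump (- \<xi>) = inf_jump \<xi>" for \<xi> by (simp add: inf_jump_def jump_minus)
  show "ennreal (r\<^sup>2 / (2 * pi\<^sup>2)) * inf_jump (pi / r) \<le> (INF x. moment x r)" if "0 < r" for r
    unfolding inf_jump_def
    by (rule INF_greatest, rule order_trans[OF mult_left_mono moment_lower[OF that]])
       (auto intro: INF_lower)
  show "ennreal (8 / r\<^sup>2) * (INF x. moment x r) \<le> inf_jump (pi / r)" if "0 < r" for r
    unfolding inf_jump_def
    by (rule INF_greatest, rule order_trans[OF mult_left_mono moment_upper[OF that]])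
       (auto intro: INF_lower)
qed measurable

lemma sup_jump_le_sup_symbol: "sup_jump \<xi> \<le> sup_symbol \<xi>"
  unfolding sup_jump_def sup_symbol_def cmod_symbol
  by (intro SUP_mono' ennreal_leI) (use c_nonneg in auto)

lemma inf_jump_le_inf_symbol: "inf_jump \<xi> \<le> inf_symbol \<xi>"
  unfolding inf_jump_def inf_symbol_def Re_symbol
  by (intro INF_mono' ennreal_leI) (use c_nonneg in auto)

text \<open>A common zero of all jump symbols is a common period, so
  \<open>nn_integral_inverse_SUP_finite\<close> applies. Hence the radius is immaterial, which
  reconciles an arbitrary \<rho> with the existence of some \<open>s\<close>.\<close>

lemma sup_jump_finite_cong:
  assumes "0 < s" "0 < t"
  shows "(\<integral>\<^sup>+\<xi>\<in>{\<xi>. \<bar>\<xi>\<bar> < s}. inverse (sup_jump \<xi>) \<partial>lborel) < \<infinity> \<longleftrightarrow>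
    (\<integral>\<^sup>+\<xi>\<in>{\<xi>. \<bar>\<xi>\<bar> < t}. inverse (sup_jump \<xi>) \<partial>lborel) < \<infinity>"
proof -
  have "jump x (\<eta> + h) = jump x h" if "\<And>x. jump x \<eta> \<le> 0" for x \<eta> h
    using levy_measure.jump_symbol_periodic[OF levy_measure_nu, of x \<eta> h] that[of x] jump_nonneg[of x \<eta>]
    by simp
  note * = nn_integral_inverse_SUP_finite[where f = jump, OF continuous_jump this]
  show ?thesis unfolding sup_jump_def using *[OF _ assms(1)] *[OF _ assms(2)] assms by blast
qed

text \<open>Without jumps the symbol is at most a multiple of \<open>\<xi>\<^sup>2\<close>, whose
  inverse is not integrable at 0. Otherwise one measure with jumps gives a quadratic lower bound
  near 0 that absorbs the diffusion. Its \<open>\<delta>\<close> is not known in advance, so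
  divergence is assumed for every radius.\<close>

lemma sup_symbol_infinite:
  assumes inf: "\<And>s. 0 < s \<Longrightarrow> (\<integral>\<^sup>+\<xi>\<in>{\<xi>. \<bar>\<xi>\<bar> < s}. inverse (sup_jump \<xi>) \<partial>lborel) = \<infinity>"
  shows "\<exists>s>0. (\<integral>\<^sup>+\<xi>\<in>{\<xi>. \<bar>\<xi>\<bar> < s}. inverse (sup_symbol \<xi>) \<partial>lborel) = \<infinity>"
proof -
  obtain C where C: "0 < C" "\<And>x. c x \<le> C" using diffusion_bounded by blast
  show ?thesis
  proof (cases "\<forall>x. AE y in \<nu> x. y = 0")
    case True
    have jump0: "jump x \<xi> = 0" for x \<xi>
    proof -
      have "jump x \<xi> = (\<integral>y. 0 \<partial>\<nu> x)"
        unfolding levy_measure.jump_symbol_def[OF levy_measure_nu]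
        by (rule integral_cong_AE)
          (use True[rule_format, of x] levy_measure.integrable_one_minus_cos[OF levy_measure_nu] in auto)
      then show ?thesis by simp
    qed
    \<comment> \<open>The tail lemma with constant \<open>A\<close> reduces the divergence at 0 to
      the infinite length of a half-line. The value C / 4 makes the lower bound an equality, and the
      upper one amounts to \<open>4 \<le> pi\<^sup>2\<close>.\<close>
    have "(\<integral>\<^sup>+r\<in>{pi<..}. inverse (ennreal (C / 4)) \<partial>lborel) < \<infinity> \<longleftrightarrow>
      (\<integral>\<^sup>+\<xi>\<in>{\<xi>. \<bar>\<xi>\<bar> < pi / pi}. inverse (ennreal (C / 2 * \<xi>\<^sup>2)) \<partial>lborel) < \<infinity>"
    proof (rule nn_integral_tail_iff_near_zero)
      fix r :: real assume r: "0 < r"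
      show "ennreal (r\<^sup>2 / (2 * pi\<^sup>2)) * ennreal (C / 2 * (pi / r)\<^sup>2) \<le> ennreal (C / 4)"
        using r C(1) by (simp add: ennreal_mult[symmetric] power_divide)
      have "2\<^sup>2 \<le> pi\<^sup>2" using pi_ge_two by (intro power_mono) auto
      then have "8 / r\<^sup>2 * (C / 4) \<le> C / 2 * (pi / r)\<^sup>2"
        using r C(1) by (simp add: power_divide divide_simps)
      then show "ennreal (8 / r\<^sup>2) * ennreal (C / 4) \<le> ennreal (C / 2 * (pi / r)\<^sup>2)"
        using C(1) by (simp add: ennreal_mult[symmetric] ennreal_leI)
    qed auto
    moreover have "(\<integral>\<^sup>+r\<in>{pi<..}. inverse (ennreal (C / 4)) \<partial>lborel) = \<infinity>"
    proof -
      have "(\<integral>\<^sup>+r\<in>{pi<..}. inverse (ennreal (C / 4)) \<partial>lborel) =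
          inverse (ennreal (C / 4)) * emeasure lborel {pi<..}"
        by (subst nn_integral_cmult_indicator) auto
      moreover have "emeasure lborel {pi<..} = \<infinity>"
      proof (cases "emeasure lborel {pi<..}")
        case (real x)
        have "emeasure lborel {pi<..pi + (x + 1)} \<le> emeasure lborel {pi<..}"
          by (intro emeasure_mono) auto
        with real show ?thesis by simp
      qed simp
      ultimately show ?thesis using C(1) by (simp add: ennreal_mult_top inverse_ennreal)
    qed
    ultimately have "(\<integral>\<^sup>+\<xi>\<in>{\<xi>. \<bar>\<xi>\<bar> < 1}. inverse (ennreal (C / 2 * \<xi>\<^sup>2)) \<partial>lborel) = \<infinity>"
      by (simp flip: less_top)
    moreover have "(\<integral>\<^sup>+\<xi>\<in>{\<xi>. \<bar>\<xi>\<bar> < 1}. inverse (ennreal (C / 2 * \<xi>\<^sup>2)) \<partial>lborel) \<le>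
        (\<integral>\<^sup>+\<xi>\<in>{\<xi>. \<bar>\<xi>\<bar> < 1}. inverse (sup_symbol \<xi>) \<partial>lborel)"
    proof (intro nn_integral_mono mult_right_mono ennreal_inverse_antimono)
      fix \<xi>
      show "sup_symbol \<xi> \<le> ennreal (C / 2 * \<xi>\<^sup>2)"
        unfolding sup_symbol_def cmod_symbol jump0
        using C(2) by (intro SUP_least ennreal_leI) (auto intro!: divide_right_mono mult_right_mono)
    qed auto
    ultimately show ?thesis by (intro exI[of _ 1]) (simp add: top_unique)
  next
    case False
    then obtain x where "\<not> (AE y in \<nu> x. y = 0)" by blast
    then obtain k \<delta> where k: "0 < k" "0 < \<delta>" "\<And>\<xi>. \<bar>\<xi>\<bar> < \<delta> \<Longrightarrow> k * \<xi>\<^sup>2 \<le> jump x \<xi>"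
      using levy_measure.jump_symbol_ge_quadratic[OF levy_measure_nu] by metis
    \<comment> \<open>C / (2k) pays for the diffusion at any starting point through the jumps at
      \<open>x\<close>, and 1 for the jumps at that point itself.\<close>
    define K where "K = C / (2 * k) + 1"
    have K: "0 < K" using C(1) k(1) by (auto simp: K_def intro!: add_nonneg_pos)
    have le: "sup_symbol \<xi> \<le> ennreal K * sup_jump \<xi>" if \<xi>: "\<bar>\<xi>\<bar> < \<delta>" for \<xi>
      unfolding sup_symbol_def cmod_symbol
    proof (rule SUP_least)
      fix z
      have "c z * \<xi>\<^sup>2 / 2 \<le> C * \<xi>\<^sup>2 / 2"
        using C(2) by (intro divide_right_mono mult_right_mono) auto
      also have "\<dots> = C / (2 * k) * (k * \<xi>\<^sup>2)" using k(1) by simp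
      also have "\<dots> \<le> C / (2 * k) * jump x \<xi>"
        using k C(1) \<xi> by (intro mult_left_mono) auto
      finally have "ennreal (c z * \<xi>\<^sup>2 / 2 + jump z \<xi>) \<le> ennreal (C / (2 * k) * jump x \<xi> + jump z \<xi>)"
        by (intro ennreal_leI) simp
      also have "\<dots> = ennreal (C / (2 * k)) * ennreal (jump x \<xi>) + ennreal (jump z \<xi>)"
        using jump_nonneg C(1) k(1)
        by (simp add: ennreal_mult[symmetric] ennreal_plus[symmetric] del: ennreal_plus)
      also have "\<dots> \<le> ennreal (C / (2 * k)) * sup_jump \<xi> + sup_jump \<xi>"
        unfolding sup_jump_def by (intro add_mono mult_left_mono SUP_upper) auto
      also have "\<dots> = ennreal K * sup_jump \<xi>"
        using C(1) k(1) by (simp add: K_def ennreal_plus distrib_right)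
      finally show "ennreal (c z * \<xi>\<^sup>2 / 2 + jump z \<xi>) \<le> ennreal K * sup_jump \<xi>" .
    qed
    have "\<not> (\<integral>\<^sup>+\<xi>\<in>{\<xi>. \<bar>\<xi>\<bar> < \<delta>}. inverse (sup_symbol \<xi>) \<partial>lborel) < \<infinity>"
    proof
      assume fin: "(\<integral>\<^sup>+\<xi>\<in>{\<xi>. \<bar>\<xi>\<bar> < \<delta>}. inverse (sup_symbol \<xi>) \<partial>lborel) < \<infinity>"
      have "(\<integral>\<^sup>+\<xi>\<in>{\<xi>. \<bar>\<xi>\<bar> < \<delta>}. inverse (sup_jump \<xi>) \<partial>lborel) < \<infinity>"
      proof (rule nn_integral_finite_comparison[OF _ _ fin])
        show "inverse (sup_jump \<xi>) * indicator {\<xi>. \<bar>\<xi>\<bar> < \<delta>} \<xi> \<le>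
            ennreal K * (inverse (sup_symbol \<xi>) * indicator {\<xi>. \<bar>\<xi>\<bar> < \<delta>} \<xi>)" for \<xi>
          using ennreal_inverse_le_mult[OF K le] by (auto simp: indicator_def)
      qed measurable
      with inf[OF k(2)] show False by simp
    qed
    with k(2) show ?thesis by (auto simp flip: less_top)
  qed
qed

section \<open>The two criteria\<close>

text \<open>Both sides are compared with the integral of \<open>inverse (sup_jump \<xi>)\<close>:
  the forward direction adds the diffusion by \<open>sup_symbol_infinite\<close>, the backward one
  drops it by monotonicity.\<close>

lemma sup_criterion:
  assumes "0 < \<rho>"
  shows "(\<integral>\<^sup>+r\<in>{\<rho><..}. inverse (SUP x. moment x r) \<partial>lborel) = \<infinity> \<longleftrightarrow>
    (\<exists>s>0. (\<integral>\<^sup>+\<xi>\<in>{\<xi>. \<bar>\<xi>\<bar> < s}. inverse (SUP x. ennreal (cmod (q x \<xi>))) \<partial>lborel) = \<infinity>)"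
    (is "?L \<longleftrightarrow> ?R")
proof -
  have \<rho>: "0 < pi / \<rho>" using assms by simp
  have L: "?L \<longleftrightarrow> (\<integral>\<^sup>+\<xi>\<in>{\<xi>. \<bar>\<xi>\<bar> < pi / \<rho>}. inverse (sup_jump \<xi>) \<partial>lborel) = \<infinity>"
    using sup_moment_iff_sup_jump[OF assms] by (simp flip: less_top)
  show ?thesis
  proof
    assume ?L
    then have "(\<integral>\<^sup>+\<xi>\<in>{\<xi>. \<bar>\<xi>\<bar> < s}. inverse (sup_jump \<xi>) \<partial>lborel) = \<infinity>" if "0 < s" for s
      using L sup_jump_finite_cong[OF \<rho> that] by (simp flip: less_top)
    then show ?R using sup_symbol_infinite by (simp add: sup_symbol_def)
  next
    assume ?R
    then obtain s where s: "0 < s"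
      "(\<integral>\<^sup>+\<xi>\<in>{\<xi>. \<bar>\<xi>\<bar> < s}. inverse (sup_symbol \<xi>) \<partial>lborel) = \<infinity>"
      by (auto simp: sup_symbol_def)
    have "(\<integral>\<^sup>+\<xi>\<in>{\<xi>. \<bar>\<xi>\<bar> < s}. inverse (sup_symbol \<xi>) \<partial>lborel) \<le>
        (\<integral>\<^sup>+\<xi>\<in>{\<xi>. \<bar>\<xi>\<bar> < s}. inverse (sup_jump \<xi>) \<partial>lborel)"
      by (intro nn_integral_mono mult_right_mono ennreal_inverse_antimono sup_jump_le_sup_symbol) auto
    with s have "(\<integral>\<^sup>+\<xi>\<in>{\<xi>. \<bar>\<xi>\<bar> < s}. inverse (sup_jump \<xi>) \<partial>lborel) = \<infinity>"
      by (simp add: top_unique)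
    then show ?L using L sup_jump_finite_cong[OF \<rho> s(1)] by (simp flip: less_top)
  qed
qed

text \<open>The limit puts the symbol above \<open>C * \<xi>\<^sup>2\<close> near 0, with C a bound
  for \<open>c\<close>. The diffusion is then at most half of the symbol, so jump part and symbol
  are comparable uniformly in the starting point.\<close>

lemma inf_criterion:
  assumes lim: "filterlim (\<lambda>\<xi>. (INF x. Re (q x \<xi>)) / \<xi>\<^sup>2) at_top (at 0)"
  shows "(\<exists>s>0. (\<integral>\<^sup>+\<xi>\<in>{\<xi>. \<bar>\<xi>\<bar> < s}. inverse (INF x. ennreal (Re (q x \<xi>))) \<partial>lborel) < \<infinity>) \<longleftrightarrow>
    (\<forall>\<^sub>F \<rho> in at_top. (\<integral>\<^sup>+r\<in>{\<rho><..}. inverse (INF x. moment x r) \<partial>lborel) < \<infinity>)"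
    (is "?L \<longleftrightarrow> ?R")
proof
  obtain C where C: "0 < C" "\<And>x. c x \<le> C" using diffusion_bounded by blast
  have "\<forall>\<^sub>F \<xi> in at 0. C \<le> (INF x. Re (q x \<xi>)) / \<xi>\<^sup>2"
    using lim by (simp add: filterlim_at_top)
  then obtain \<delta> where \<delta>: "0 < \<delta>" "\<And>\<xi>. \<xi> \<noteq> 0 \<Longrightarrow> \<bar>\<xi>\<bar> < \<delta> \<Longrightarrow> C \<le> (INF x. Re (q x \<xi>)) / \<xi>\<^sup>2"
    by (auto simp: eventually_at dist_real_def)
  have half: "Re (q x \<xi>) \<le> 2 * jump x \<xi>" if \<xi>: "\<bar>\<xi>\<bar> < \<delta>" for x \<xi>
  proof (cases "\<xi> = 0")
    case True
    then show ?thesis using jump_nonneg[of x 0] by (simp add: Re_symbol)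
  next
    case False
    have "C * \<xi>\<^sup>2 \<le> (INF x. Re (q x \<xi>))" using \<delta>(2)[OF False \<xi>] False by (simp add: field_simps)
    \<comment> \<open>This infimum is taken in the reals, where it needs the lower bound 0.\<close>
    also have "\<dots> \<le> Re (q x \<xi>)"
      by (intro cINF_lower bdd_belowI2[of _ 0]) (auto simp: Re_symbol symbol_nonneg)
    finally have "c x * \<xi>\<^sup>2 \<le> Re (q x \<xi>)"
      using mult_right_mono[OF C(2)[of x], of "\<xi>\<^sup>2"] by simp
    then show ?thesis by (simp add: Re_symbol)
  qed
  have le: "inf_symbol \<xi> \<le> ennreal 2 * inf_jump \<xi>" if \<xi>: "\<bar>\<xi>\<bar> < \<delta>" for \<xi>
  proof -
    \<comment> \<open>The factor stands on the side of the smaller term, so that the estimate can be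
      made for each starting point separately.\<close>
    have "ennreal (1 / 2) * inf_symbol \<xi> \<le> inf_jump \<xi>"
      unfolding inf_jump_def
    proof (rule INF_greatest)
      fix x
      have "ennreal (1 / 2) * inf_symbol \<xi> \<le> ennreal (1 / 2) * ennreal (Re (q x \<xi>))"
        unfolding inf_symbol_def by (intro mult_left_mono INF_lower) auto
      also have "\<dots> = ennreal (1 / 2 * Re (q x \<xi>))"
        using symbol_nonneg[of x \<xi>] by (intro ennreal_mult[symmetric]) (auto simp: Re_symbol)
      also have "\<dots> \<le> ennreal (jump x \<xi>)" using half[OF \<xi>, of x] by (intro ennreal_leI) simp
      finally show "ennreal (1 / 2) * inf_symbol \<xi> \<le> ennreal (jump x \<xi>)" .
    qed
    then have "ennreal 2 * (ennreal (1 / 2) * inf_symbol \<xi>) \<le> ennreal 2 * inf_jump \<xi>"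
      by (rule mult_left_mono) simp
    also have "ennreal 2 * (ennreal (1 / 2) * inf_symbol \<xi>) = inf_symbol \<xi>"
      by (simp only: mult.assoc[symmetric] ennreal_mult[symmetric]) simp
    finally show ?thesis .
  qed
  {
    assume ?L
    then obtain s where s: "0 < s"
      "(\<integral>\<^sup>+\<xi>\<in>{\<xi>. \<bar>\<xi>\<bar> < s}. inverse (inf_symbol \<xi>) \<partial>lborel) < \<infinity>"
      by (auto simp: inf_symbol_def)
    show ?R
      unfolding eventually_at_top_linorder
    proof (intro exI allI impI)
      \<comment> \<open>Large \<rho> makes pi / \<rho> at most both \<open>s\<close> and
        \<open>\<delta>\<close>.\<close>
      fix \<rho> assume \<rho>: "max (pi / s) (pi / \<delta>) \<le> \<rho>"
      have "0 < pi / s" using s(1) by simp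
      with \<rho> have pos: "0 < \<rho>" by linarith
      have small: "pi / \<rho> \<le> s" "pi / \<rho> \<le> \<delta>"
        using \<rho> s(1) \<delta>(1) pos by (auto simp: field_simps)
      have "(\<integral>\<^sup>+\<xi>\<in>{\<xi>. \<bar>\<xi>\<bar> < pi / \<rho>}. inverse (inf_jump \<xi>) \<partial>lborel) < \<infinity>"
      proof (rule nn_integral_finite_comparison[OF _ _ s(2)])
        show "inverse (inf_jump \<xi>) * indicator {\<xi>. \<bar>\<xi>\<bar> < pi / \<rho>} \<xi> \<le>
            ennreal 2 * (inverse (inf_symbol \<xi>) * indicator {\<xi>. \<bar>\<xi>\<bar> < s} \<xi>)" for \<xi>
          using ennreal_inverse_le_mult[OF _ le, of \<xi>] small by (auto simp: indicator_def)
      qed measurable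
      then show "(\<integral>\<^sup>+r\<in>{\<rho><..}. inverse (INF x. moment x r) \<partial>lborel) < \<infinity>"
        by (simp only: inf_moment_iff_inf_jump[OF pos])
    qed
  }
  {
    assume ?R
    then have "\<forall>\<^sub>F \<rho> in at_top. 0 < \<rho> \<and> (\<integral>\<^sup>+r\<in>{\<rho><..}. inverse (INF x. moment x r) \<partial>lborel) < \<infinity>"
      by (intro eventually_conj eventually_gt_at_top)
    then obtain \<rho> where \<rho>: "0 < \<rho>" "(\<integral>\<^sup>+r\<in>{\<rho><..}. inverse (INF x. moment x r) \<partial>lborel) < \<infinity>"
      using eventually_happens[of _ "at_top :: real filter"] by force
    have "(\<integral>\<^sup>+\<xi>\<in>{\<xi>. \<bar>\<xi>\<bar> < pi / \<rho>}. inverse (inf_symbol \<xi>) \<partial>lborel) \<le>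
        (\<integral>\<^sup>+\<xi>\<in>{\<xi>. \<bar>\<xi>\<bar> < pi / \<rho>}. inverse (inf_jump \<xi>) \<partial>lborel)"
      by (intro nn_integral_mono mult_right_mono ennreal_inverse_antimono inf_jump_le_inf_symbol) auto
    also have "\<dots> < \<infinity>" using \<rho>(2) by (simp only: inf_moment_iff_inf_jump[OF \<rho>(1)])
    finally show ?L using \<rho>(1) by (intro exI[of _ "pi / \<rho>"]) (simp add: inf_symbol_def)
  }
qed

end

theorem theorem3p7:
  fixes M :: "'w measure" and P :: "real \<Rightarrow> 'w measure" and F :: "real \<Rightarrow> 'w \<Rightarrow> real"
    and a b c :: "real \<Rightarrow> real" and \<nu> :: "real \<Rightarrow> real measure"
    and q :: "real \<Rightarrow> real \<Rightarrow> complex"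
  assumes "symmetric_nice_feller_process M P F a b c \<nu> q"
  shows
    "(\<forall>\<rho>>0.
       (\<integral>\<^sup>+r\<in>{\<rho><..}. inverse (SUP x. \<integral>\<^sup>+y\<in>{0..r}. ennreal y * R \<nu> x r y \<partial>lborel) \<partial>lborel) = \<infinity>
       \<longleftrightarrow> (\<exists>s>0. (\<integral>\<^sup>+\<xi>\<in>{\<xi>. \<bar>\<xi>\<bar> < s}. inverse (SUP x. ennreal (cmod (q x \<xi>))) \<partial>lborel) = \<infinity>))
     \<and>
     (filterlim (\<lambda>\<xi>. (INF x. Re (q x \<xi>)) / \<xi>\<^sup>2) at_top (at 0) \<longrightarrow>
       ((\<exists>s>0. (\<integral>\<^sup>+\<xi>\<in>{\<xi>. \<bar>\<xi>\<bar> < s}. inverse (INF x. ennreal (Re (q x \<xi>))) \<partial>lborel) < \<infinity>)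
       \<longleftrightarrow> (\<forall>\<^sub>F \<rho> in at_top.
             (\<integral>\<^sup>+r\<in>{\<rho><..}. inverse (INF x. \<integral>\<^sup>+y\<in>{0..r}. ennreal y * R \<nu> x r y \<partial>lborel) \<partial>lborel) < \<infinity>)))"
proof -
  interpret symmetric_nice_feller_process M P F a b c \<nu> q by (rule assms)
  show ?thesis using sup_criterion inf_criterion by blast
qed

end
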